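(* Let $\Re\alpha>0$. For all $t>0$, the fractional integral of order $\alpha$ of the Bessel function of the first kind with respect to the order is $$D_{\nu-\nu_{0}}^{-\alpha}J_{\nu}(t)=\frac{1}{\pi}\left\{\int_{0}^{\pi}x^{-\alpha}\,\Re\left(e^{i(t\sin x-\nu x+\pi\alpha/2)}P\left(\alpha,-ix(\nu-\nu_{0})\right)\right)dx-\int_{0}^{\infty}e^{-t\sinh x}\,\Im\left(e^{(i\pi-x)\nu}\frac{P\left(\alpha,(i\pi-x)(\nu-\nu_{0})\right)}{(i\pi-x)^{\alpha}}\right)dx\right\}.$$
   Context: $J_\nu(t)=\left(\frac t2\right)^{\nu}\sum_{k=0}^{\infty}\frac{(-1)^k(t/2)^{2k}}{k!\,\Gamma(\nu+k+1)}$ is the Bessel function of the first kind. Fractional integration of order $\alpha$, $\Re\alpha>0$, is defined by $$D_{\nu-\nu_0}^{-\alpha}f(\nu)=\frac{1}{\Gamma(\alpha)}\int_{\nu_0}^{\nu}(\nu-\mu)^{\alpha-1}f(\mu)\,d\mu ,$$ and $D_{\nu-\nu_0}^{-\alpha}J_\nu(t)$ means this with $f(\mu)=J_\mu(t)$ and $t$ fixed. $P(a,z)=\frac{1}{\Gamma(a)}\int_0^z u^{a-1}e^{-u}\,du$, $\Re a>0$, is the regularized lower incomplete gamma function. $\Re$ and $\Im$ denote real and imaginary parts.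
   Formalization: Proved for real ν₀ ≤ ν. The formula holds literally for real α>0; for non-real α, where literal Re and Im make it false, they are replaced by their analytic continuations in α: (F(α)+conj F(conj α))/2 and (F(α)−conj F(conj α))/(2i). *)

theory Defs
  imports "HOL-Analysis.Analysis" "HOL-Complex_Analysis.Complex_Analysis"
begin

text \<open>
  The factor \<open>rGamma\<close> is the entire function \<open>1 / Gamma\<close>, so terms at the poles of \<open>Gamma\<close> vanish,
  as usual. The power \<open>powr\<close> on complex numbers is the principal branch throughout.
\<close>

definition bessel_J :: "complex \<Rightarrow> complex \<Rightarrow> complex" where
  "bessel_J \<nu> t =
     (t / 2) powr \<nu> * (\<Sum>k. (-1) ^ k * (t / 2) ^ (2 * k) / fact k * rGamma (\<nu> + of_nat k + 1))"

text \<open>Riemann--Liouville integral, for a real variable \<open>\<nu>\<close> and base point \<open>\<nu>\<^sub>0 \<le> \<nu>\<close>.\<close>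

definition frac_integrand :: "complex \<Rightarrow> (real \<Rightarrow> complex) \<Rightarrow> real \<Rightarrow> real \<Rightarrow> complex" where
  "frac_integrand \<alpha> f \<nu> \<mu> = of_real (\<nu> - \<mu>) powr (\<alpha> - 1) * f \<mu>"

definition frac_integral :: "complex \<Rightarrow> real \<Rightarrow> (real \<Rightarrow> complex) \<Rightarrow> real \<Rightarrow> complex" where
  "frac_integral \<alpha> \<nu>\<^sub>0 f \<nu> = 1 / Gamma \<alpha> * (LBINT \<mu>=ereal \<nu>\<^sub>0..ereal \<nu>. frac_integrand \<alpha> f \<nu> \<mu>)"

text \<open>
  The path from \<open>0\<close> to \<open>z\<close> is the straight segment, on which the principal power is continuous
  except at \<open>0\<close>.
\<close>

definition reg_lower_gamma :: "complex \<Rightarrow> complex \<Rightarrow> complex" where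
  "reg_lower_gamma a z =
     1 / Gamma a * contour_integral (linepath 0 z) (\<lambda>u. u powr (a - 1) * exp (- u))"

text \<open>
  Real and imaginary part of a parameter-dependent expression \<open>F \<alpha>\<close>, taken as for real \<open>\<alpha>\<close> and
  continued analytically in \<open>\<alpha>\<close>: they are analytic in \<open>\<alpha>\<close> if \<open>F\<close> is, and agree with \<open>Re (F \<alpha>)\<close>
  and \<open>Im (F \<alpha>)\<close> for real \<open>\<alpha>\<close>. The literal \<open>Re (F \<alpha>)\<close> at non-real \<open>\<alpha>\<close> is not analytic
  in \<open>\<alpha>\<close>, whereas a fractional integral is.
\<close>

definition Re_param :: "(complex \<Rightarrow> complex) \<Rightarrow> complex \<Rightarrow> complex" where
  "Re_param F \<alpha> = (F \<alpha> + cnj (F (cnj \<alpha>))) / 2"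

definition Im_param :: "(complex \<Rightarrow> complex) \<Rightarrow> complex \<Rightarrow> complex" where
  "Im_param F \<alpha> = (F \<alpha> - cnj (F (cnj \<alpha>))) / (2 * \<i>)"

lemma Re_param_real: "\<alpha> \<in> \<real> \<Longrightarrow> Re_param F \<alpha> = of_real (Re (F \<alpha>))"
  by (simp add: Re_param_def Reals_cnj_iff complex_add_cnj)

lemma Im_param_real: "\<alpha> \<in> \<real> \<Longrightarrow> Im_param F \<alpha> = of_real (Im (F \<alpha>))"
  by (auto elim!: Reals_cases simp: Im_param_def complex_eq_iff)

end

theory Submission
  imports Defs "HOL-Real_Asymp.Real_Asymp"
begin

text \<open>
  Schlaefli's formula
  \<open>\<pi> J\<^sub>\<mu>(t) = \<integral>\<^sub>0\<^sup>\<pi> cos (t sin x - \<mu> x) dx - \<integral>\<^sub>0\<^sup>\<infinity> exp (- t sinh x - \<mu> x) sin (\<pi> \<mu>) dx\<close>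
  is integrated against \<open>(\<nu> - \<mu>) powr (\<alpha> - 1)\<close>. By Fubini the \<open>\<mu>\<close>-integral comes first, and both
  kernels are combinations of exponentials \<open>exp (w \<mu>)\<close>, whose fractional integral is
  \<open>exp (w \<nu>) P(\<alpha>, w (\<nu> - \<nu>\<^sub>0)) / w powr \<alpha>\<close>, with \<open>w = \<plusminus>\<i> x\<close> for the first kernel and
  \<open>w = \<plusminus>\<i> \<pi> - x\<close> for the second.

  Schlaefli's formula in turn is Hankel's integral for \<open>1 / Gamma\<close> summed over the Bessel series. For
  \<open>1 / Gamma (1 - s)\<close> with \<open>s \<ge> 0\<close> the contour can be collapsed onto the negative axis, where
  Euler's integral and the reflection formula apply; the case \<open>s < 0\<close> follows because both sides
  satisfy the same recurrence in \<open>s\<close>.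
\<close>

section \<open>Hankel's integral for the reciprocal Gamma function\<close>

text \<open>The substitution \<open>u = c * exp x\<close> links the whole real line with Euler's
  integral over the positive axis. It is applied as \<open>x = ln (u / c)\<close>, whose Jacobian is
  \<open>1 / u\<close>.\<close>

lemma Gamma_integral_exp:
  fixes s c :: real
  assumes "s > 0" "c > 0"
  shows "set_integrable lborel UNIV (\<lambda>x. exp (s * x - c * exp x))"
    and "(LINT x:UNIV|lborel. exp (s * x - c * exp x)) = Gamma s * c powr (- s)"
proof -
  let ?f = "\<lambda>x. exp (s * x - c * exp x)"
  let ?h = "\<lambda>u. u powr (s - 1) / exp u"
  have hi: "(?h has_integral Gamma s) {0<..}"
    by (subst has_integral_spike_set_eq[of "{0<..}" "{0..}"])
       (auto intro: negligible_subset[OF negligible_sing[of 0]] Gamma_integral_real[OF \<open>s > 0\<close>])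
  have nn: "?h absolutely_integrable_on {0<..}"
    by (rule nonnegative_absolutely_integrable_1) (use hi in \<open>auto simp: integrable_on_def\<close>)
  have hl: "set_integrable lborel {0<..} ?h"
    using nn unfolding set_integrable_def
    by (subst (asm) integrable_completion) auto
  have hv: "(LINT u:{0<..}|lborel. ?h u) = Gamma s"
    using set_borel_integral_eq_integral[OF hl] hi by (simp add: integral_unique)
  have eq: "?f (ln (u / c)) * (1 / u) = c powr (- s) * ?h u" if "u > 0" for u
  proof -
    have "?f (ln (u / c)) = exp (s * ln u) * exp (- s * ln c) / exp u"
      using that \<open>c > 0\<close> by (simp add: ln_div exp_diff exp_add algebra_simps exp_minus field_simps)
    thus ?thesis
      using that \<open>c > 0\<close> by (simp add: powr_def exp_diff algebra_simps)
  qed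
  have ein: "einterval 0 \<infinity> = {0::real<..}" "einterval (-\<infinity>) \<infinity> = (UNIV::real set)"
    by (auto simp: einterval_def)
  have fg: "set_integrable lborel (einterval 0 \<infinity>) (\<lambda>u. ?f (ln (u / c)) * (1 / u))"
    unfolding ein
    by (subst set_integrable_cong[OF refl refl eq])
       (use set_integrable_mult_right[of "c powr (- s)", OF hl] in auto)
  have A: "((ereal \<circ> (\<lambda>u. ln (u / c)) \<circ> real_of_ereal) \<longlongrightarrow> -\<infinity>) (at_right 0)"
  proof -
    have "filterlim (\<lambda>u. ln (u / c)) at_bot (at_right 0)" using \<open>c > 0\<close> by real_asymp
    thus ?thesis unfolding zero_ereal_def
      by (simp add: ereal_tendsto_simps flip: comp_assoc)
  qed
  have B: "((ereal \<circ> (\<lambda>u. ln (u / c)) \<circ> real_of_ereal) \<longlongrightarrow> \<infinity>) (at_left \<infinity>)"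
  proof -
    have "filterlim (\<lambda>u. ln (u / c)) at_top at_top" using \<open>c > 0\<close> by real_asymp
    thus ?thesis by (simp add: ereal_tendsto_simps flip: comp_assoc)
  qed
  note sub = interval_integral_substitution_nonneg[where a=0 and b=\<infinity> and f="?f" and
      g="\<lambda>u. ln (u / c)" and g'="\<lambda>u. 1 / u", OF _ _ _ _ _ _ A B fg]
  have s1: "set_integrable lborel (einterval (-\<infinity>) \<infinity>) ?f"
    using \<open>c > 0\<close> by (intro sub(1)) (auto intro!: derivative_eq_intros continuous_intros)
  have s2: "(LBINT x=-\<infinity>..\<infinity>. ?f x) = (LBINT u=0..\<infinity>. ?f (ln (u / c)) * (1 / u))"
    using \<open>c > 0\<close> by (intro sub(2)) (auto intro!: derivative_eq_intros continuous_intros)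
  show "set_integrable lborel UNIV ?f" using s1 by (simp add: ein)
  have "(LINT x:UNIV|lborel. ?f x) = (LINT u:{0<..}|lborel. ?f (ln (u / c)) * (1 / u))"
    using s2 by (simp add: interval_lebesgue_integral_def ein)
  also have "\<dots> = (LINT u:{0<..}|lborel. c powr (- s) * ?h u)"
    by (rule set_lebesgue_integral_cong) (use eq in auto)
  also have "\<dots> = Gamma s * c powr (- s)"
    by (subst set_integral_mult_right) (simp add: hv)
  finally show "(LINT x:UNIV|lborel. ?f x) = Gamma s * c powr (- s)" .
qed

text \<open>For \<open>s \<le> 0\<close> integrability over the whole line fails, but to the right
  of \<open>y\<close> the coefficient \<open>s\<close> may be raised to the positive number
  \<open>\<bar>s\<bar> + 1\<close> at the cost of a constant factor.\<close>

lemma integrable_exp_exp: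
  fixes s c :: real
  assumes "c > 0"
  shows "set_integrable lborel {y<..} (\<lambda>x. exp (s * x - c * exp x))"
proof (rule set_integrable_bound)
  show "set_integrable lborel {y<..} (\<lambda>x. exp ((\<bar>s\<bar> + 1 - s) * \<bar>y\<bar>) * exp ((\<bar>s\<bar> + 1) * x - c * exp x))"
    using set_integrable_subset[OF Gamma_integral_exp(1)[of "\<bar>s\<bar> + 1" c], of "{y<..}"] assms by auto
  show "set_borel_measurable lborel {y<..} (\<lambda>x. exp (s * x - c * exp x))"
    by (simp add: set_borel_measurable_def)
  have "s * x \<le> (\<bar>s\<bar> + 1 - s) * \<bar>y\<bar> + (\<bar>s\<bar> + 1) * x" if "y < x" for x
  proof -
    have "0 \<le> (\<bar>s\<bar> + 1 - s) * (\<bar>y\<bar> + x)" using that by (intro mult_nonneg_nonneg) auto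
    thus ?thesis by (simp add: algebra_simps)
  qed
  thus "AE x in lborel. x \<in> {y<..} \<longrightarrow> norm (exp (s * x - c * exp x))
      \<le> norm (exp ((\<bar>s\<bar> + 1 - s) * \<bar>y\<bar>) * exp ((\<bar>s\<bar> + 1) * x - c * exp x))"
    by (auto simp flip: exp_add)
qed

definition hankel_arc :: "real \<Rightarrow> real \<Rightarrow> real \<Rightarrow> real" where
  "hankel_arc c s y =
     (LBINT v=0..ereal pi. exp (s * y + c * exp y * cos v) * cos (c * exp y * sin v + s * v))"

text \<open>
  \<open>hankel_arc\<close> and \<open>hankel_ray\<close> are the pieces of Hankel's contour integral for \<open>rGamma (1 - s)\<close>
  in logarithmic coordinates: the integrand is \<open>exp (c * exp z + s * z)\<close>, and the contour
  consists of the half-lines \<open>Im z = \<plusminus>\<pi>\<close>, \<open>Re z > y\<close> and the segment between their end points.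
  The conjugate halves are combined, and \<open>hankel_ray\<close> (for \<open>y = 0\<close>) omits the factor \<open>sin (pi * s)\<close>.
\<close>

lemma hankel_arc_rectangle:
  assumes "y \<le> 0"
  shows "hankel_arc c s 0 = hankel_arc c s y + sin (pi * s) * (LINT x:{y..0}|lborel. exp (s * x - c * exp x))"
proof -
  define g where "g z = exp (of_real s * z + of_real c * exp z)" for z :: complex
  obtain P where P: "\<And>z. (P has_field_derivative g z) (at z)"
  proof -
    have "g holomorphic_on UNIV" unfolding g_def by (intro holomorphic_intros)
    thus ?thesis using that by (rule holomorphic_convex_primitive'[of UNIV g, rotated 2]) auto
  qed
  have g_eq: "g (Complex x v) = exp (s * x + c * exp x * cos v) *
      cis (c * exp x * sin v + s * v)" for x v
    by (simp add: g_def complex_eq_iff Re_exp Im_exp algebra_simps)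
  have arc: "hankel_arc c s x = Im (P (Complex x pi)) - Im (P (Complex x 0))" for x
  proof -
    have "((\<lambda>v. Im (P (Complex x v))) has_vector_derivative
        exp (s * x + c * exp x * cos v) * cos (c * exp x * sin v + s * v)) (at v within A)" for v A
    proof -
      have "((\<lambda>v. Complex x v) has_vector_derivative \<i>) (at v within A)"
        unfolding Complex_eq by (auto intro!: derivative_eq_intros)
      from field_vector_diff_chain_within[OF this, of P "g (Complex x v)"]
      have "((\<lambda>v. P (Complex x v)) has_vector_derivative \<i> * g (Complex x v)) (at v within A)"
        using P by (auto simp: comp_def intro: has_field_derivative_at_within)
      hence "((\<lambda>v. Im (P (Complex x v))) has_vector_derivative Im (\<i> * g (Complex x v))) (at v within A)"
        by (rule bounded_linear.has_vector_derivative[OF bounded_linear_Im])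
      thus ?thesis by (simp add: g_eq)
    qed
    from interval_integral_FTC_finite[OF _ this, of 0 pi] show ?thesis
      by (simp add: hankel_arc_def continuous_intros flip: zero_ereal_def)
  qed
  \<comment> \<open>For \<open>sin v = 0\<close> the phase of \<open>g\<close> along the horizontal
    line is the constant \<open>s * v\<close>, so the sine leaves the integral.\<close>
  have edge: "Im (P (Complex 0 v)) - Im (P (Complex y v))
      = sin (s * v) * (LINT x:{y..0}|lborel. exp (s * x + c * exp x * cos v))" if "sin v = 0" for v
  proof -
    have "((\<lambda>x. Im (P (Complex x v))) has_vector_derivative
        sin (s * v) * exp (s * x + c * exp x * cos v)) (at x within A)" for x A
    proof -
      have "((\<lambda>x. Complex x v) has_vector_derivative 1) (at x within A)"
        unfolding Complex_eq by (auto intro!: derivative_eq_intros)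
      from field_vector_diff_chain_within[OF this, of P "g (Complex x v)"]
      have "((\<lambda>x. P (Complex x v)) has_vector_derivative 1 * g (Complex x v)) (at x within A)"
        using P by (auto simp: comp_def intro: has_field_derivative_at_within)
      hence "((\<lambda>x. Im (P (Complex x v))) has_vector_derivative Im (1 * g (Complex x v))) (at x within A)"
        by (rule bounded_linear.has_vector_derivative[OF bounded_linear_Im])
      thus ?thesis using that by (simp add: g_eq mult_ac)
    qed
    from interval_integral_FTC_finite[OF _ this, of y 0] assms
    have "(LBINT x=y..0. sin (s * v) * exp (s * x + c * exp x * cos v)) = Im (P (Complex 0 v)) - Im (P (Complex y v))"
      by (simp add: continuous_intros flip: zero_ereal_def)
    thus ?thesis using assms unfolding zero_ereal_def by (simp add: interval_integral_Icc)
  qed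
  show ?thesis
    using edge[of pi] edge[of 0] by (simp add: arc mult_ac)
qed

text \<open>As the segment moves to the left, \<open>exp (s * y)\<close> kills the integrand for
  \<open>s > 0\<close>, whereas for \<open>s = 0\<close> the integrand tends to 1 and the length
  \<pi> of the segment remains. Since \<open>s \<ge> 0\<close>, the constant \<open>exp c\<close>
  dominates for every \<open>n\<close>.\<close>

lemma hankel_arc_limit:
  assumes "c > 0" "s \<ge> 0"
  shows "(\<lambda>n. hankel_arc c s (- real n)) \<longlonglongrightarrow> (if s = 0 then pi else 0)"
proof -
  let ?f = "\<lambda>y v. indicator {0..pi} v *\<^sub>R (exp (s * y + c * exp y * cos v) * cos (c * exp y * sin v + s * v))"
  let ?l = "\<lambda>v. indicator {0..pi} v *\<^sub>R (if s = 0 then 1 else 0 :: real)"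
  have "(\<lambda>n. \<integral>v. ?f (- real n) v \<partial>lborel) \<longlonglongrightarrow> (\<integral>v. ?l v \<partial>lborel)"
  proof (rule integral_dominated_convergence[where w="\<lambda>v. indicator {0..pi} v *\<^sub>R exp c"])
    show "integrable lborel (\<lambda>v. indicator {0..pi} v *\<^sub>R exp c)"
      using borel_integrable_atLeastAtMost'[of 0 pi "\<lambda>_. exp c"] by (simp add: set_integrable_def)
    show "AE v in lborel. (\<lambda>n. ?f (- real n) v) \<longlonglongrightarrow> ?l v"
    proof (intro AE_I2 tendsto_scaleR tendsto_const)
      fix v :: real
      have exp0: "(\<lambda>n. exp (- real n)) \<longlonglongrightarrow> 0" by real_asymp
      show "(\<lambda>n. exp (s * (- real n) + c * exp (- real n) * cos v) * cos (c * exp (- real n) * sin v + s * v))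
        \<longlonglongrightarrow> (if s = 0 then 1 else 0)"
      proof (cases "s = 0")
        case True
        have "(\<lambda>n. exp (c * exp (- real n) * cos v) * cos (c * exp (- real n) * sin v))
          \<longlonglongrightarrow> exp (c * 0 * cos v) * cos (c * 0 * sin v)"
          by (intro tendsto_intros exp0)
        thus ?thesis using True by simp
      next
        case False
        with assms have "s > 0" by simp
        have 1: "(\<lambda>n. exp (s * - real n)) \<longlonglongrightarrow> 0" using \<open>s > 0\<close> by real_asymp
        have 2: "(\<lambda>n. exp (c * exp (- real n) * cos v)) \<longlonglongrightarrow> exp (c * 0 * cos v)"
          by (intro tendsto_intros exp0)
        have 3: "(\<lambda>n. cos (c * exp (- real n) * sin v + s * v)) \<longlonglongrightarrow> cos (c * 0 * sin v + s * v)"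
          by (intro tendsto_intros exp0)
        show ?thesis
          using tendsto_mult[OF tendsto_mult[OF 1 2] 3] False unfolding exp_add by simp
      qed
    qed
    show "AE v in lborel. norm (?f (- real n) v) \<le> indicator {0..pi} v *\<^sub>R exp c" for n
    proof (intro AE_I2)
      fix v :: real
      have "c * (exp (- real n) * cos v) \<le> c * (1 * 1)"
        using assms by (intro mult_left_mono order_trans[OF mult_left_mono[OF cos_le_one]]) auto
      moreover have "s * (- real n) \<le> 0" using assms by simp
      ultimately have "exp (s * (- real n) + c * exp (- real n) * cos v) \<le> exp c" by (simp add: mult_ac)
      hence "exp (s * (- real n) + c * exp (- real n) * cos v) * \<bar>cos (c * exp (- real n) * sin v + s * v)\<bar> \<le> exp c * 1"
        by (intro mult_mono) auto
      thus "norm (?f (- real n) v) \<le> indicator {0..pi} v *\<^sub>R exp c"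
        by (auto simp: indicator_def abs_mult)
    qed
  qed auto
  thus ?thesis
    unfolding hankel_arc_def zero_ereal_def
    by (cases "s = 0") (simp_all add: interval_integral_Icc set_lebesgue_integral_def)
qed

definition hankel_ray :: "real \<Rightarrow> real \<Rightarrow> real" where
  "hankel_ray c s = (LBINT x=0..\<infinity>. exp (s * x - c * exp x))"

lemma hankel_nonneg:
  assumes "c > 0" "s \<ge> 0"
  shows "hankel_arc c s 0 + sin (pi * s) * hankel_ray c s = pi * c powr (- s) * rGamma (1 - s)"
proof (cases "s = 0")
  case True
  \<comment> \<open>With \<open>s = 0\<close> the factor \<open>sin (pi * s)\<close> vanishes, so
    the divergent integral over the negative half-line never enters.\<close>
  have "hankel_arc c s 0 = hankel_arc c s (- real n)" for n
    using hankel_arc_rectangle[of "- real n" c s] True by simp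
  hence "hankel_arc c s 0 = pi"
    using hankel_arc_limit[OF assms] True by (simp add: LIMSEQ_const_iff)
  thus ?thesis using True assms by simp
next
  case False
  let ?f = "\<lambda>x. exp (s * x - c * exp x)"
  from False assms have "s > 0" by simp
  note G = Gamma_integral_exp[OF \<open>s > 0\<close> \<open>c > 0\<close>]
  have sub: "set_integrable lborel A ?f" if "A \<in> sets borel" for A
    by (rule set_integrable_subset[OF G(1)]) (use that in auto)
  have "((\<lambda>y. LINT x:{y..0}|lborel. ?f x) \<longlongrightarrow> (LINT x:{..0}|lborel. ?f x)) at_bot"
    by (rule tendsto_set_lebesgue_integral_at_bot) (auto intro: sub)
  hence "(\<lambda>n. LINT x:{- real n..0}|lborel. ?f x) \<longlonglongrightarrow> (LINT x:{..0}|lborel. ?f x)"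
    by (rule filterlim_compose) real_asymp
  hence "(\<lambda>n. hankel_arc c s (- real n) + sin (pi * s) * (LINT x:{- real n..0}|lborel. ?f x))
      \<longlonglongrightarrow> 0 + sin (pi * s) * (LINT x:{..0}|lborel. ?f x)"
    using hankel_arc_limit[OF assms] False by (intro tendsto_intros) auto
  moreover have "hankel_arc c s (- real n) + sin (pi * s) * (LINT x:{- real n..0}|lborel. ?f x) = hankel_arc c s 0" for n
    using hankel_arc_rectangle[of "- real n" c s] by simp
  \<comment> \<open>The arc thus supplies the missing left half of the ray, and adding
    \<open>hankel_ray\<close> completes Euler's integral over the whole line.\<close>
  ultimately have 1: "hankel_arc c s 0 = sin (pi * s) * (LINT x:{..0}|lborel. ?f x)"
    by (simp add: LIMSEQ_const_iff)
  have "(LINT x:{..0}\<union>{0<..}|lborel. ?f x) = (LINT x:{..0}|lborel. ?f x) + (LINT x:{0<..}|lborel. ?f x)"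
    by (rule set_integral_Un) (auto intro: sub)
  also have "{..0}\<union>{0<..} = (UNIV :: real set)" by auto
  finally have "Gamma s * c powr (- s) = (LINT x:{..0}|lborel. ?f x) + hankel_ray c s"
    using G(2) unfolding hankel_ray_def zero_ereal_def by (simp add: interval_integral_to_infinity_eq)
  hence 2: "hankel_arc c s 0 + sin (pi * s) * hankel_ray c s = sin (pi * s) * Gamma s * c powr (- s)"
    unfolding 1 mult.assoc by (simp only: distrib_left)
  \<comment> \<open>The reflection formula is kept in terms of \<open>rGamma\<close>, because
    \<open>1 - s\<close> may be a pole of \<open>Gamma\<close>.\<close>
  have "complex_of_real (rGamma s * rGamma (1 - s)) = of_real (sin (pi * s) / pi)"
    using rGamma_reflection_complex[of "of_real s"] 
    by (simp flip: rGamma_complex_of_real sin_of_real)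
  hence refl: "rGamma s * rGamma (1 - s) = sin (pi * s) / pi" by (simp only: of_real_eq_iff)
  have inv: "Gamma s * rGamma s = 1" using Gamma_real_pos[OF \<open>s > 0\<close>]
    by (simp add: rGamma_inverse_Gamma)
  have "pi * rGamma (1 - s) = pi * (Gamma s * rGamma s) * rGamma (1 - s)" by (simp add: inv)
  also have "\<dots> = pi * Gamma s * (rGamma s * rGamma (1 - s))" by (simp only: mult_ac)
  also have "\<dots> = sin (pi * s) * Gamma s" by (simp add: refl)
  finally have 3: "pi * rGamma (1 - s) = sin (pi * s) * Gamma s" .
  have "pi * c powr (- s) * rGamma (1 - s) = (pi * rGamma (1 - s)) * c powr (- s)"
    by (simp only: mult_ac)
  also have "\<dots> = sin (pi * s) * Gamma s * c powr (- s)" by (simp only: 3)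
  finally show ?thesis unfolding 2 by (rule sym)
qed

text \<open>Integration by parts along the contour: the derivative of
  \<open>exp (c * exp z + s * z)\<close> combines the integrands for \<open>s\<close> and
  \<open>s + 1\<close>. The boundary term \<open>exp (- c) * sin (pi * s)\<close> of the arc cancels
  that of the ray, and \<open>sin (pi * (s + 1)) = - sin (pi * s)\<close> accounts for the sign of
  \<open>exp z\<close> on the ray.\<close>

lemma hankel_recurrence:
  assumes "c > 0"
  shows "s * (hankel_arc c s 0 + sin (pi * s) * hankel_ray c s) +
    c * (hankel_arc c (s + 1) 0 + sin (pi * (s + 1)) * hankel_ray c (s + 1)) = 0"
proof -
  let ?a = "\<lambda>s v. exp (c * cos v) * cos (c * sin v + s * v)"
  let ?r = "\<lambda>s x. exp (s * x - c * exp x)"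
  have "((\<lambda>v. exp (c * cos v) * sin (c * sin v + s * v)) has_vector_derivative
      s * ?a s v + c * ?a (s + 1) v) (at v within A)" for v A
  proof -
    have "c * sin v + (s + 1) * v = (c * sin v + s * v) + v" by (simp add: algebra_simps)
    thus ?thesis
      unfolding has_real_derivative_iff_has_vector_derivative[symmetric]
      by (auto intro!: derivative_eq_intros simp: cos_add sin_add algebra_simps)
  qed
  from interval_integral_FTC_finite[OF _ this, of 0 pi]
  have A: "(LBINT v=0..pi. s * ?a s v + c * ?a (s + 1) v) = exp (- c) * sin (pi * s)"
    by (simp add: continuous_intros mult.commute flip: zero_ereal_def)
  have ia: "interval_lebesgue_integrable lborel 0 (ereal pi) (?a s)" for s
    unfolding zero_ereal_def by (rule interval_integrable_continuous_on) (auto intro!: continuous_intros)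
  have A': "s * hankel_arc c s 0 + c * hankel_arc c (s + 1) 0 = exp (- c) * sin (pi * s)"
    using A ia unfolding hankel_arc_def by (simp flip: zero_ereal_def)
  have ein: "einterval 0 \<infinity> = {0::real<..}" by (auto simp: einterval_def)
  have ir: "interval_lebesgue_integrable lborel 0 \<infinity> (?r s)" for s
    using integrable_exp_exp[OF assms, of 0 s] by (simp add: interval_lebesgue_integrable_def ein)
  have "((?r s \<circ> real_of_ereal) \<longlongrightarrow> exp (- c)) (at_right 0)"
  proof -
    have "(?r s \<longlongrightarrow> ?r s 0) (at_right 0)" by (intro tendsto_intros)
    thus ?thesis unfolding zero_ereal_def by (simp add: ereal_tendsto_simps)
  qed
  moreover have "((?r s \<circ> real_of_ereal) \<longlongrightarrow> 0) (at_left \<infinity>)"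
  proof -
    have "(?r s \<longlongrightarrow> 0) at_top" using assms by real_asymp
    thus ?thesis by (simp add: ereal_tendsto_simps)
  qed
  moreover have "interval_lebesgue_integrable lborel 0 \<infinity> (\<lambda>x. s * ?r s x - c * ?r (s + 1) x)"
    using ir by (intro interval_lebesgue_integral_diff interval_lebesgue_integrable_mult_right) auto
  moreover have "(?r s has_vector_derivative (s * ?r s x - c * ?r (s + 1) x)) (at x)" for x
    unfolding has_real_derivative_iff_has_vector_derivative[symmetric]
    by (auto intro!: derivative_eq_intros simp: algebra_simps simp flip: exp_add)
  ultimately have "(LBINT x=0..\<infinity>. s * ?r s x - c * ?r (s + 1) x) = 0 - exp (- c)"
    by (intro interval_integral_FTC_integrable[where F="?r s"])
       (auto simp: interval_lebesgue_integrable_def intro!: continuous_intros)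
  hence B: "s * hankel_ray c s - c * hankel_ray c (s + 1) = - exp (- c)"
    using ir unfolding hankel_ray_def by simp
  have "sin (pi * (s + 1)) = - sin (pi * s)" by (simp add: distrib_left)
  hence "s * (hankel_arc c s 0 + sin (pi * s) * hankel_ray c s) +
    c * (hankel_arc c (s + 1) 0 + sin (pi * (s + 1)) * hankel_ray c (s + 1)) =
    (s * hankel_arc c s 0 + c * hankel_arc c (s + 1) 0) + sin (pi * s) * (s * hankel_ray c s - c * hankel_ray c (s + 1))"
    by (simp add: algebra_simps)
  also have "\<dots> = 0" by (simp add: A' B)
  finally show ?thesis .
qed

lemma hankel_rGamma:
  assumes "c > 0"
  shows "hankel_arc c s 0 + sin (pi * s) * hankel_ray c s = pi * c powr (- s) * rGamma (1 - s)"
proof -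
  \<comment> \<open>The range of \<open>s\<close> is extended to the left in unit steps: for
    \<open>s < 0\<close> the recurrence reduces \<open>s\<close> times the claim to the claim at
    \<open>s + 1\<close>, and the nonzero factor \<open>s\<close> is cancelled.\<close>
  have "hankel_arc c s 0 + sin (pi * s) * hankel_ray c s = pi * c powr (- s) * rGamma (1 - s)"
    if "s \<ge> - real n" for n s
    using that
  proof (induction n arbitrary: s)
    case 0
    thus ?case using hankel_nonneg[OF assms] by simp
  next
    case (Suc n)
    show ?case
    proof (cases "s \<ge> 0")
      case False
      have "s * (hankel_arc c s 0 + sin (pi * s) * hankel_ray c s) =
          - c * (hankel_arc c (s + 1) 0 + sin (pi * (s + 1)) * hankel_ray c (s + 1))"
        using hankel_recurrence[OF assms, of s] by linarith
      also have "\<dots> = - c * (pi * c powr (- (s + 1)) * rGamma (1 - (s + 1)))"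
        using Suc.prems by (subst Suc.IH) auto
      also have "\<dots> = - pi * (c * c powr (- (s + 1))) * rGamma (- s)" by simp
      also have "c * c powr (- (s + 1)) = c powr (- s)"
        using assms by (simp add: powr_mult_base)
      also have "rGamma (- s) = - s * rGamma (1 - s)"
        using rGamma_plus1[of "- s"] by simp
      finally have "s * (hankel_arc c s 0 + sin (pi * s) * hankel_ray c s) = s * (pi * c powr (- s) * rGamma (1 - s))"
        by (simp add: mult_ac)
      moreover have "s \<noteq> 0" using False by simp
      ultimately show ?thesis by (simp only: mult_cancel_left simp_thms)
    qed (use hankel_nonneg[OF assms] in auto)
  qed
  from this[of "nat \<lceil>\<bar>s\<bar>\<rceil>" s] show ?thesis by linarith
qed

section \<open>Schlaefli's integral for the Bessel function\<close>

text \<open>Termwise integration under a majorant that separates into a summable factor in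
  \<open>k\<close> and an integrable factor in \<open>x\<close>; both Hankel pieces have majorants
  of this shape.\<close>

lemma interval_integral_sums:
  fixes f :: "nat \<Rightarrow> real \<Rightarrow> 'a::{banach, second_countable_topology}" and a b :: ereal
  assumes "a \<le> b"
    and meas: "\<And>k. f k \<in> borel_measurable borel"
    and w: "interval_lebesgue_integrable lborel a b w"
    and bound: "\<And>k x. x \<in> einterval a b \<Longrightarrow> norm (f k x) \<le> C k * w x"
    and "summable C"
    and sums: "\<And>x. x \<in> einterval a b \<Longrightarrow> (\<lambda>k. f k x) sums g x"
  shows "(\<lambda>k. LBINT x=a..b. f k x) sums (LBINT x=a..b. g x)"
proof -
  define I where "I = einterval a b"
  have I[measurable]: "I \<in> sets borel" by (simp add: I_def)
  define h where "h k x = indicator I x *\<^sub>R f k x" for k x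
  have iw: "integrable lborel (\<lambda>x. indicator I x * w x)"
    using w \<open>a \<le> b\<close> by (simp add: interval_lebesgue_integrable_def set_integrable_def I_def)
  have hb: "norm (h k x) \<le> C k * (indicator I x * w x)" for k x
    using bound[of x k] by (auto simp: h_def I_def indicator_def)
  have int: "integrable lborel (h k)" for k
  proof (rule Bochner_Integration.integrable_bound)
    show "integrable lborel (\<lambda>x. C k * (indicator I x * w x))" using iw by simp
    show "h k \<in> borel_measurable lborel"
      unfolding h_def using meas[of k] by (auto intro!: borel_measurable_scaleR)
    show "AE x in lborel. norm (h k x) \<le> norm (C k * (indicator I x * w x))"
      by (intro AE_I2 order_trans[OF hb]) simp
  qed
  have "(\<lambda>k. integral\<^sup>L lborel (h k)) sums (\<integral>x. (\<Sum>k. h k x) \<partial>lborel)"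
  proof (rule sums_integral[OF int])
    show "AE x in lborel. summable (\<lambda>k. norm (h k x))"
      by (intro AE_I2 summable_comparison_test'[OF summable_mult2[OF \<open>summable C\<close>]])
         (use hb in auto)
    show "summable (\<lambda>k. \<integral>x. norm (h k x) \<partial>lborel)"
    proof (rule summable_comparison_test'[OF summable_mult2[OF \<open>summable C\<close>]])
      fix k :: nat
      have "(\<integral>x. norm (h k x) \<partial>lborel) \<le> (\<integral>x. C k * (indicator I x * w x) \<partial>lborel)"
        using int iw hb by (intro integral_mono) auto
      thus "norm (\<integral>x. norm (h k x) \<partial>lborel) \<le> C k * (\<integral>x. indicator I x * w x \<partial>lborel)" by simp
    qed
  qed
  moreover have "(\<Sum>k. h k x) = indicator I x *\<^sub>R g x" for x
    using sums[of x] by (auto simp: h_def I_def indicator_def sums_iff)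
  ultimately show ?thesis
    using \<open>a \<le> b\<close>
    by (simp add: interval_lebesgue_integral_def set_lebesgue_integral_def h_def[abs_def] I_def)
qed

text \<open>In Hankel's integrand with \<open>s = - \<mu> - k\<close> the index enters only through
  \<open>exp (- z) ^ k\<close>, so the sum over \<open>k\<close> is an exponential series with value
  \<open>exp (- c * exp (- z))\<close>. For \<open>z = \<i> * v\<close> the exponents
  \<open>c * exp z\<close> and \<open>- c * exp (- z)\<close> add up to
  \<open>2 * \<i> * c * sin v\<close>.\<close>

lemma hankel_arc_series:
  assumes "c > 0"
  shows "(\<lambda>k. (- c) ^ k / fact k * hankel_arc c (- \<mu> - real k) 0) sums
    (LBINT v=0..ereal pi. cos (2 * c * sin v - \<mu> * v))"
proof -
  let ?f = "\<lambda>k v. (- c) ^ k / fact k * (exp (c * cos v) * cos (c * sin v + (- \<mu> - real k) * v))"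
  have "(\<lambda>k. LBINT v=0..ereal pi. ?f k v) sums (LBINT v=0..ereal pi. cos (2 * c * sin v - \<mu> * v))"
  proof (rule interval_integral_sums)
    show "interval_lebesgue_integrable lborel 0 (ereal pi) (\<lambda>_. exp c)"
      unfolding zero_ereal_def by (rule interval_integrable_continuous_on) auto
    show "summable (\<lambda>k. c ^ k / fact k)"
      using summable_exp[of c] by (simp add: field_simps)
    show "norm (?f k v) \<le> c ^ k / fact k * exp c" for k v
    proof -
      have "exp (c * cos v) * \<bar>cos (c * sin v + (- \<mu> - real k) * v)\<bar> \<le> exp c * 1"
        using assms by (intro mult_mono) auto
      thus ?thesis using assms
        by (simp add: abs_mult power_abs divide_right_mono mult_left_mono)
    qed
    show "(\<lambda>k. ?f k v) sums cos (2 * c * sin v - \<mu> * v)" for v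
    proof -
      \<comment> \<open>The real part of \<open>exp Z\<close> is the integrand at
        \<open>k = 0\<close>, and \<open>W\<close> carries the dependence on \<open>k\<close>. The
        real parts of \<open>Z\<close> and \<open>W\<close> cancel, which leaves a number of modulus
        1.\<close>
      define Z where "Z = Complex (c * cos v) (c * sin v - \<mu> * v)"
      define W where "W = of_real (- c) * cis (- v)"
      have "(\<lambda>k. exp Z * (W ^ k /\<^sub>R fact k)) sums (exp Z * exp W)"
        by (intro sums_mult exp_converges)
      hence "(\<lambda>k. Re (exp Z * (W ^ k /\<^sub>R fact k))) sums Re (exp Z * exp W)"
        by (rule sums_Re)
      moreover have "Re (exp Z * (W ^ k /\<^sub>R fact k)) = ?f k v" for k
      proof -
        have W: "W ^ k = of_real ((- c) ^ k) * cis (real k * (- v))"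
          by (simp only: W_def power_mult_distrib Complex.DeMoivre of_real_power)
        have "exp Z * (W ^ k /\<^sub>R fact k) = of_real ((- c) ^ k / fact k * exp (c * cos v)) *
            (cis (c * sin v - \<mu> * v) * cis (real k * (- v)))"
          unfolding W
          by (simp add: Z_def exp_eq_polar scaleR_conv_of_real field_simps)
        also have "cis (c * sin v - \<mu> * v) * cis (real k * (- v)) = cis (c * sin v + (- \<mu> - real k) * v)"
          unfolding cis_mult by (simp add: algebra_simps)
        finally show ?thesis
          by (simp only: times_complex.sel Re_complex_of_real Im_complex_of_real cis.sel mult_zero_left diff_zero mult.assoc)
      qed
      moreover have "Re (exp Z * exp W) = cos (2 * c * sin v - \<mu> * v)"
        by (simp add: Z_def W_def Re_exp mult.assoc flip: exp_add)
      ultimately show ?thesis by simp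
    qed
  qed auto
  thus ?thesis by (simp add: hankel_arc_def)
qed

text \<open>The same summation on the line \<open>Im z = \<pi>\<close>: the sign
  \<open>(- 1) ^ k\<close> from the sine cancels that of \<open>(- c) ^ k\<close>, so the series
  sums to \<open>exp (c * exp (- x))\<close>. Together with \<open>exp (- c * exp x)\<close> this is
  \<open>exp (- 2 * c * sinh x)\<close>.\<close>

lemma hankel_ray_series:
  assumes "c > 0"
  shows "(\<lambda>k. (- c) ^ k / fact k * (sin (pi * (- \<mu> - real k)) * hankel_ray c (- \<mu> - real k))) sums
    (LBINT x=0..\<infinity>. - (exp (- (2 * c) * sinh x) * (sin (pi * \<mu>) * exp (- \<mu> * x))))"
proof -
  let ?f = "\<lambda>k x. (- c) ^ k / fact k * (sin (pi * (- \<mu> - real k)) * exp ((- \<mu> - real k) * x - c * exp x))"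
  have "(\<lambda>k. LBINT x=0..\<infinity>. ?f k x) sums
      (LBINT x=0..\<infinity>. - (exp (- (2 * c) * sinh x) * (sin (pi * \<mu>) * exp (- \<mu> * x))))"
  proof (rule interval_integral_sums)
    have "einterval 0 \<infinity> = {0::real<..}" by (auto simp: einterval_def)
    thus "interval_lebesgue_integrable lborel 0 \<infinity> (\<lambda>x. exp (- \<mu> * x - c * exp x))"
      using integrable_exp_exp[OF assms, of 0 "- \<mu>"] by (simp add: interval_lebesgue_integrable_def)
    show "summable (\<lambda>k. c ^ k / fact k)"
      using summable_exp[of c] by (simp add: field_simps)
    show "norm (?f k x) \<le> c ^ k / fact k * exp (- \<mu> * x - c * exp x)" if "x \<in> einterval 0 \<infinity>" for k x
    proof -
      have "\<bar>sin (pi * (- \<mu> - real k))\<bar> * exp ((- \<mu> - real k) * x - c * exp x) \<le> 1 * exp (- \<mu> * x - c * exp x)"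
        using that by (intro mult_mono) (auto simp: einterval_def algebra_simps)
      thus ?thesis using assms
        by (simp add: abs_mult power_abs divide_right_mono mult_left_mono)
    qed
    show "(\<lambda>k. ?f k x) sums (- (exp (- (2 * c) * sinh x) * (sin (pi * \<mu>) * exp (- \<mu> * x))))" for x
    proof -
      have "(\<lambda>k. - (sin (pi * \<mu>) * exp (- \<mu> * x - c * exp x)) * ((c * exp (- x)) ^ k /\<^sub>R fact k)) sums
          (- (sin (pi * \<mu>) * exp (- \<mu> * x - c * exp x)) * exp (c * exp (- x)))"
        by (intro sums_mult exp_converges)
      moreover have "- (sin (pi * \<mu>) * exp (- \<mu> * x - c * exp x)) * ((c * exp (- x)) ^ k /\<^sub>R fact k) = ?f k x" for k
      proof -
        have s: "sin (pi * (- \<mu> - real k)) = - ((- 1) ^ k * sin (pi * \<mu>))"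
          by (simp add: algebra_simps sin_diff sin_add)
        have e: "exp ((- \<mu> - real k) * x - c * exp x) = exp (- \<mu> * x - c * exp x) * exp (- x) ^ k"
          by (simp add: exp_of_nat_mult[symmetric] algebra_simps flip: exp_add)
        have p: "(- c) ^ k = (- 1) ^ k * c ^ k" by (rule power_minus)
        show ?thesis unfolding s e p
          by (simp add: power_mult_distrib field_simps flip: power_add mult_2)
      qed
      moreover have "- (sin (pi * \<mu>) * exp (- \<mu> * x - c * exp x)) * exp (c * exp (- x)) =
          - (exp (- (2 * c) * sinh x) * (sin (pi * \<mu>) * exp (- \<mu> * x)))"
      proof -
        have "exp (- \<mu> * x - c * exp x) * exp (c * exp (- x)) = exp (- (2 * c) * sinh x) * exp (- \<mu> * x)"
          unfolding exp_add[symmetric] by (simp add: sinh_field_def field_simps)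
        thus ?thesis by (simp add: algebra_simps)
      qed
      ultimately show ?thesis by (simp only:)
    qed
  qed auto
  thus ?thesis by (simp add: hankel_ray_def)
qed

text \<open>With \<open>c = t / 2\<close> and \<open>s = - \<mu> - k\<close>,
  \<open>hankel_rGamma\<close> yields the reciprocal Gamma factor of the k-th Bessel term times
  \<open>c powr (\<mu> + k)\<close>. The weight \<open>(- c) ^ k / fact k\<close> supplies the sign,
  the factorial and the missing power of \<open>c\<close>, so the arc and ray series add up to \<pi>
  times the Bessel function.\<close>

lemma bessel_J_Schlaefli:
  fixes \<mu> t :: real
  assumes "t > 0"
  shows "bessel_J (of_real \<mu>) (of_real t) = of_real (1 / pi *
    ((LBINT x=0..ereal pi. cos (t * sin x - \<mu> * x)) -
     (LBINT x=0..\<infinity>. exp (- t * sinh x) * (sin (pi * \<mu>) * exp (- \<mu> * x)))))" (is "_ = of_real (1 / pi * ?S)")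
proof -
  define c where "c = t / 2"
  have c: "c > 0" "2 * c = t" using assms by (auto simp: c_def)
  let ?b = "\<lambda>k. (- 1) ^ k * c ^ (2 * k) / fact k * rGamma (\<mu> + real k + 1)"
  have "(\<lambda>k. (- c) ^ k / fact k * (hankel_arc c (- \<mu> - real k) 0
      + sin (pi * (- \<mu> - real k)) * hankel_ray c (- \<mu> - real k))) sums ?S"
    using sums_add[OF hankel_arc_series[OF c(1), of \<mu>] hankel_ray_series[OF c(1), of \<mu>]] c(2)
    by (simp add: distrib_left interval_lebesgue_integral_uminus)
  also have "(\<lambda>k. (- c) ^ k / fact k * (hankel_arc c (- \<mu> - real k) 0
      + sin (pi * (- \<mu> - real k)) * hankel_ray c (- \<mu> - real k))) = (\<lambda>k. pi * c powr \<mu> * ?b k)"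
  proof
    fix k
    have e1: "c powr (- (- \<mu> - real k)) = c powr \<mu> * c ^ k"
      using c by (simp add: powr_add powr_realpow)
    have e2: "1 - (- \<mu> - real k) = \<mu> + real k + 1" by simp
    have e3: "(- c) ^ k * c ^ k = (- 1) ^ k * c ^ (2 * k)"
      by (simp add: power_minus[of c] mult_2 power_add)
    have "(- c) ^ k / fact k * (hankel_arc c (- \<mu> - real k) 0
        + sin (pi * (- \<mu> - real k)) * hankel_ray c (- \<mu> - real k))
      = pi * c powr \<mu> * (((- c) ^ k * c ^ k) / fact k * rGamma (\<mu> + real k + 1))"
      unfolding hankel_rGamma[OF c(1)] e1 e2 by simp
    thus "(- c) ^ k / fact k * (hankel_arc c (- \<mu> - real k) 0
        + sin (pi * (- \<mu> - real k)) * hankel_ray c (- \<mu> - real k)) = pi * c powr \<mu> * ?b k"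
      unfolding e3 .
  qed
  finally have "(\<lambda>k. pi * c powr \<mu> * ?b k) sums ?S" .
  hence "(\<lambda>k. 1 / (pi * c powr \<mu>) * (pi * c powr \<mu> * ?b k)) sums (1 / (pi * c powr \<mu>) * ?S)"
    by (rule sums_mult)
  hence "?b sums (?S / (pi * c powr \<mu>))" using c by simp
  hence "(\<lambda>k. complex_of_real (?b k)) sums of_real (?S / (pi * c powr \<mu>))"
    by (subst sums_of_real_iff)
  hence "(\<Sum>k. (- 1) ^ k * of_real c ^ (2 * k) / fact k * rGamma (complex_of_real \<mu> + of_nat k + 1))
      = of_real (?S / (pi * c powr \<mu>))"
    by (simp add: sums_iff flip: rGamma_complex_of_real)
  moreover have "complex_of_real t / 2 = of_real c" by (simp add: c_def)
  ultimately have "bessel_J (of_real \<mu>) (of_real t) = of_real (c powr \<mu>) * of_real (?S / (pi * c powr \<mu>))"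
    using c by (simp add: bessel_J_def powr_of_real)
  moreover have "c powr \<mu> * (?S / (pi * c powr \<mu>)) = 1 / pi * ?S" using c by simp
  ultimately show ?thesis by (simp only: of_real_mult [symmetric])
qed

section \<open>Fractional integrals of exponentials\<close>

text \<open>The norm is \<open>(\<nu> - \<mu>) powr (r - 1)\<close> with \<open>r = Re a\<close>.
  Its primitive \<open>- ((\<nu> - \<mu>) powr r / r)\<close> has a finite limit at the singular end
  point because \<open>r > 0\<close>.\<close>

lemma set_integrable_complex_power:
  fixes \<nu>\<^sub>0 \<nu> :: real
  assumes "Re a > 0"
  shows "set_integrable lborel {\<nu>\<^sub>0<..<\<nu>} (\<lambda>\<mu>. complex_of_real (\<nu> - \<mu>) powr (a - 1))"
proof (cases "\<nu>\<^sub>0 < \<nu>")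
  case True
  define r where "r = Re a"
  have r: "r > 0" using assms by (simp add: r_def)
  have "set_integrable lborel (einterval \<nu>\<^sub>0 \<nu>) (\<lambda>\<mu>. (\<nu> - \<mu>) powr (r - 1))"
  proof (rule interval_integral_FTC_nonneg(1))
    show "ereal \<nu>\<^sub>0 < ereal \<nu>" using True by simp
    show "((\<lambda>\<mu>. - ((\<nu> - \<mu>) powr r / r)) has_real_derivative (\<nu> - \<mu>) powr (r - 1)) (at \<mu>)"
      if "ereal \<mu> < ereal \<nu>" for \<mu>
      using that r by (auto intro!: derivative_eq_intros)
    show "isCont (\<lambda>\<mu>. (\<nu> - \<mu>) powr (r - 1)) \<mu>" if "ereal \<mu> < ereal \<nu>" for \<mu>
      using that by (auto intro!: continuous_intros)
    \<comment> \<open>At \<open>x = \<nu>\<close> the base tends to 0, where continuity of the power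
      needs \<open>r > 0\<close> and a nonnegative base; hence the one-sided limit.\<close>
    have cont: "((\<lambda>\<mu>. - ((\<nu> - \<mu>) powr r / r)) \<longlongrightarrow> - ((\<nu> - x) powr r / r)) (at x within {..<\<nu>})" if "x \<le> \<nu>" for x
      using that r by (intro tendsto_intros tendsto_powr') (auto simp: eventually_at_filter)
    show "(((\<lambda>\<mu>. - ((\<nu> - \<mu>) powr r / r)) \<circ> real_of_ereal) \<longlongrightarrow> - ((\<nu> - \<nu>) powr r / r)) (at_left (ereal \<nu>))"
      using cont[of \<nu>] by (simp add: ereal_tendsto_simps)
    have "((\<lambda>\<mu>. - ((\<nu> - \<mu>) powr r / r)) \<longlongrightarrow> - ((\<nu> - \<nu>\<^sub>0) powr r / r)) (at_right \<nu>\<^sub>0)"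
      using True r by (intro tendsto_intros) auto
    thus "(((\<lambda>\<mu>. - ((\<nu> - \<mu>) powr r / r)) \<circ> real_of_ereal) \<longlongrightarrow> - ((\<nu> - \<nu>\<^sub>0) powr r / r)) (at_right (ereal \<nu>\<^sub>0))"
      by (simp add: ereal_tendsto_simps)
  qed auto
  hence *: "set_integrable lborel {\<nu>\<^sub>0<..<\<nu>} (\<lambda>\<mu>. (\<nu> - \<mu>) powr (r - 1))" by simp
  show ?thesis
  proof (rule set_integrable_bound[OF *])
    show "set_borel_measurable lborel {\<nu>\<^sub>0<..<\<nu>} (\<lambda>\<mu>. complex_of_real (\<nu> - \<mu>) powr (a - 1))"
      unfolding set_borel_measurable_def by measurable
    show "AE \<mu> in lborel. \<mu> \<in> {\<nu>\<^sub>0<..<\<nu>} \<longrightarrow>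
        norm (complex_of_real (\<nu> - \<mu>) powr (a - 1)) \<le> norm ((\<nu> - \<mu>) powr (r - 1))"
      by (intro AE_I2) (auto simp: norm_powr_real_powr r_def simp flip: of_real_diff)
  qed
qed (auto simp: set_integrable_def)

lemma set_integrable_complex_power_mult:
  fixes \<nu>\<^sub>0 \<nu> :: real and g :: "real \<Rightarrow> complex"
  assumes "Re a > 0" and g: "continuous_on UNIV g"
  shows "set_integrable lborel {\<nu>\<^sub>0<..<\<nu>} (\<lambda>\<mu>. of_real (\<nu> - \<mu>) powr (a - 1) * g \<mu>)"
proof -
  have [measurable]: "g \<in> borel_measurable borel"
    using g by (rule borel_measurable_continuous_onI)
  have "compact (g ` {\<nu>\<^sub>0..\<nu>})"
    by (intro compact_continuous_image continuous_on_subset[OF g]) auto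
  then obtain B where B: "\<forall>\<mu>\<in>{\<nu>\<^sub>0..\<nu>}. norm (g \<mu>) \<le> B"
    by (auto dest!: compact_imp_bounded simp: bounded_iff)
  show ?thesis
  proof (rule set_integrable_bound)
    show "set_integrable lborel {\<nu>\<^sub>0<..<\<nu>} (\<lambda>\<mu>. of_real (\<nu> - \<mu>) powr (a - 1) * of_real B)"
      using set_integrable_complex_power[OF assms(1)] by simp
    show "set_borel_measurable lborel {\<nu>\<^sub>0<..<\<nu>} (\<lambda>\<mu>. of_real (\<nu> - \<mu>) powr (a - 1) * g \<mu>)"
      unfolding set_borel_measurable_def by measurable
    show "AE \<mu> in lborel. \<mu> \<in> {\<nu>\<^sub>0<..<\<nu>} \<longrightarrow> norm (of_real (\<nu> - \<mu>) powr (a - 1) * g \<mu>) \<le>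
        norm (of_real (\<nu> - \<mu>) powr (a - 1) * complex_of_real B)"
    proof (intro AE_I2 impI)
      fix \<mu> assume "\<mu> \<in> {\<nu>\<^sub>0<..<\<nu>}"
      hence "norm (g \<mu>) \<le> \<bar>B\<bar>" using bspec[OF B, of \<mu>] by auto
      thus "norm (of_real (\<nu> - \<mu>) powr (a - 1) * g \<mu>) \<le> norm (of_real (\<nu> - \<mu>) powr (a - 1) * complex_of_real B)"
        by (simp add: norm_mult mult_left_mono)
    qed
  qed
qed

text \<open>Up to the factor \<open>exp (w * \<nu>) / Gamma a\<close> this is the fractional
  integral of \<open>exp (w * \<mu>)\<close>. Splitting off \<open>exp (w * \<nu>)\<close> leaves an
  exponent that depends on \<open>\<nu> - \<mu>\<close> only.\<close>

definition frac_exp :: "real \<Rightarrow> real \<Rightarrow> complex \<Rightarrow> complex \<Rightarrow> complex" where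
  "frac_exp \<nu>\<^sub>0 \<nu> a w =
     (LBINT \<mu>=ereal \<nu>\<^sub>0..ereal \<nu>. of_real (\<nu> - \<mu>) powr (a - 1) * exp (- (w * of_real (\<nu> - \<mu>))))"

text \<open>The substitution \<open>u = w * (\<nu> - \<mu>)\<close> maps the interval onto the
  straight segment that defines the incomplete gamma function. The Jacobian \<open>w\<close> and the
  factor \<open>w powr (a - 1)\<close> together give \<open>w powr a\<close>.\<close>

lemma reg_lower_gamma_conv_frac_exp:
  assumes "Re a > 0" "w \<noteq> 0" "\<nu>\<^sub>0 \<le> \<nu>"
  shows "reg_lower_gamma a (w * of_real (\<nu> - \<nu>\<^sub>0)) = w powr a / Gamma a * frac_exp \<nu>\<^sub>0 \<nu> a w"
proof (cases "\<nu>\<^sub>0 = \<nu>")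
  case True
  thus ?thesis by (simp add: reg_lower_gamma_def frac_exp_def)
next
  case False
  define L where "L = \<nu> - \<nu>\<^sub>0"
  have L: "L > 0" using False assms(3) by (simp add: L_def)
  let ?g = "\<lambda>u. u powr (a - 1) * exp (- u)"
  let ?k = "\<lambda>s. complex_of_real s powr (a - 1) * exp (- (w * of_real s))"
  let ?h = "\<lambda>\<mu>. indicator {\<nu>\<^sub>0<..<\<nu>} \<mu> *\<^sub>R ?k (\<nu> - \<mu>)"
  have "set_integrable lborel {\<nu>\<^sub>0<..<\<nu>} (\<lambda>\<mu>. ?k (\<nu> - \<mu>))"
    by (rule set_integrable_complex_power_mult[OF assms(1)]) (intro continuous_intros)
  hence "has_bochner_integral lborel ?h (frac_exp \<nu>\<^sub>0 \<nu> a w)"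
    using assms(3) by (simp add: has_bochner_integral_iff frac_exp_def set_integrable_def
        interval_lebesgue_integral_def set_lebesgue_integral_def)
  \<comment> \<open>The map \<open>\<mu> = \<nu> - L * y\<close> passes to the parameter interval of
    the segment and places the singular end \<open>\<mu> = \<nu>\<close> at
    \<open>y = 0\<close>.\<close>
  hence "has_bochner_integral lborel (\<lambda>y. ?h (\<nu> + (- L) * y)) (frac_exp \<nu>\<^sub>0 \<nu> a w /\<^sub>R \<bar>- L\<bar>)"
    using L by (subst (asm) lborel_has_bochner_integral_real_affine_iff[where c="- L" and t=\<nu>]) auto
  also have "(\<lambda>y. ?h (\<nu> + (- L) * y)) = (\<lambda>y. indicator {0<..<1} y *\<^sub>R ?k (L * y))"
  proof
    fix y
    have "\<nu> + (- L) * y \<in> {\<nu>\<^sub>0<..<\<nu>} \<longleftrightarrow> L * y < L * 1 \<and> 0 < L * y"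
      by (auto simp: L_def algebra_simps)
    hence "\<nu> + (- L) * y \<in> {\<nu>\<^sub>0<..<\<nu>} \<longleftrightarrow> y \<in> {0<..<1}"
      using L by (simp only: mult_less_cancel_left_pos) (auto simp: zero_less_mult_iff)
    thus "?h (\<nu> + (- L) * y) = indicator {0<..<1} y *\<^sub>R ?k (L * y)"
      by (simp add: indicator_def)
  qed
  finally have hb: "has_bochner_integral lborel (\<lambda>y. indicator {0<..<1} y *\<^sub>R ?k (L * y)) (frac_exp \<nu>\<^sub>0 \<nu> a w / of_real L)"
    using L by (simp add: scaleR_conv_of_real field_simps)
  hence si: "set_integrable lborel {0<..<1} (\<lambda>y. ?k (L * y))"
    by (simp add: set_integrable_def has_bochner_integral_iff)
  have "(LINT y:{0<..<1}|lborel. ?k (L * y)) = frac_exp \<nu>\<^sub>0 \<nu> a w / of_real L"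
    using hb by (simp add: set_lebesgue_integral_def has_bochner_integral_iff)
  hence "((\<lambda>y. ?k (L * y)) has_integral frac_exp \<nu>\<^sub>0 \<nu> a w / of_real L) {0<..<1}"
    using set_borel_integral_eq_integral[OF si] by (simp add: has_integral_iff)
  hence "((\<lambda>y. ?k (L * y)) has_integral frac_exp \<nu>\<^sub>0 \<nu> a w / of_real L) {0..1}"
    using has_integral_open_interval[of "\<lambda>y. ?k (L * y)" _ 0 1] by (simp add: box_real)
  hence "((\<lambda>y. w powr (a - 1) * (w * of_real L) * ?k (L * y)) has_integral
      w powr (a - 1) * (w * of_real L) * (frac_exp \<nu>\<^sub>0 \<nu> a w / of_real L)) {0..1}"
    by (rule has_integral_mult_right)
  also have "w powr (a - 1) * (w * of_real L) * (frac_exp \<nu>\<^sub>0 \<nu> a w / of_real L) = w powr a * frac_exp \<nu>\<^sub>0 \<nu> a w"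
    using L assms(2) by (simp add: powr_diff)
  finally have "((\<lambda>y. w powr (a - 1) * (w * of_real L) * ?k (L * y)) has_integral w powr a * frac_exp \<nu>\<^sub>0 \<nu> a w) {0..1}" .
  hence "((\<lambda>y. ?g (linepath 0 (w * of_real L) y) * (w * of_real L - 0)) has_integral w powr a * frac_exp \<nu>\<^sub>0 \<nu> a w) {0..1}"
  proof (rule has_integral_eq[rotated])
    fix y :: real assume y: "y \<in> {0..1}"
    \<comment> \<open>A nonnegative real factor lets the principal power split without a branch
      correction.\<close>
    have "(of_real (L * y) * w) powr (a - 1) = of_real (L * y) powr (a - 1) * w powr (a - 1)"
      using y L by (intro powr_times_real_left) auto
    moreover have "linepath 0 (w * of_real L) y = of_real (L * y) * w"
      by (simp add: linepath_def scaleR_conv_of_real)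
    ultimately show "w powr (a - 1) * (w * of_real L) * ?k (L * y) = ?g (linepath 0 (w * of_real L) y) * (w * of_real L - 0)"
      by (simp add: mult_ac)
  qed
  hence "(?g has_contour_integral w powr a * frac_exp \<nu>\<^sub>0 \<nu> a w) (linepath 0 (w * of_real L))"
    by (simp only: has_contour_integral_linepath)
  thus ?thesis
    unfolding L_def[symmetric] reg_lower_gamma_def by (simp add: contour_integral_unique)
qed

lemma set_integral_cnj:
  "(LINT x:A|M. cnj (f x)) = cnj (LINT x:A|M. f x)"
proof -
  have "(\<lambda>x. indicator A x *\<^sub>R cnj (f x)) = (\<lambda>x. cnj (indicator A x *\<^sub>R f x))"
    by (auto simp: indicator_def)
  thus ?thesis unfolding set_lebesgue_integral_def by (simp only: Bochner_Integration.integral_cnj)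
qed

text \<open>The base \<open>\<nu> - \<mu>\<close> is positive inside the interval, so conjugation
  passes through the principal power. Starting from \<open>cnj a\<close> matches
  \<open>Re_param\<close> and \<open>Im_param\<close>, which evaluate at the conjugate
  parameter.\<close>

lemma cnj_frac_exp: "cnj (frac_exp \<nu>\<^sub>0 \<nu> (cnj a) w) = frac_exp \<nu>\<^sub>0 \<nu> a (cnj w)" if "\<nu>\<^sub>0 \<le> \<nu>"
proof -
  have "cnj (frac_exp \<nu>\<^sub>0 \<nu> (cnj a) w) =
      (LBINT \<mu>=ereal \<nu>\<^sub>0..ereal \<nu>. cnj (of_real (\<nu> - \<mu>) powr (cnj a - 1) * exp (- (w * of_real (\<nu> - \<mu>)))))"
    using that by (simp only: frac_exp_def interval_lebesgue_integral_def set_integral_cnj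
        ereal_less_eq if_True)
  also have "\<dots> = frac_exp \<nu>\<^sub>0 \<nu> a (cnj w)"
    unfolding frac_exp_def
  proof (rule interval_integral_cong)
    fix \<mu> assume "\<mu> \<in> einterval (min (ereal \<nu>\<^sub>0) (ereal \<nu>)) (max (ereal \<nu>\<^sub>0) (ereal \<nu>))"
    hence "\<mu> < \<nu>" using that by (auto simp: einterval_def)
    hence "cnj (of_real (\<nu> - \<mu>) powr (cnj a - 1)) = of_real (\<nu> - \<mu>) powr (a - 1)"
      by (subst cnj_powr) auto
    thus "cnj (of_real (\<nu> - \<mu>) powr (cnj a - 1) * exp (- (w * of_real (\<nu> - \<mu>)))) =
        of_real (\<nu> - \<mu>) powr (a - 1) * exp (- (cnj w * of_real (\<nu> - \<mu>)))"
      by (simp add: exp_cnj)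
  qed
  finally show ?thesis .
qed

lemma frac_exp_integrable:
  assumes "Re a > 0" "\<nu>\<^sub>0 \<le> \<nu>"
  shows "interval_lebesgue_integrable lborel (ereal \<nu>\<^sub>0) (ereal \<nu>)
      (\<lambda>\<mu>. of_real (\<nu> - \<mu>) powr (a - 1) * exp (- (w * of_real (\<nu> - \<mu>))))"
  using assms set_integrable_complex_power_mult[of a "\<lambda>\<mu>. exp (- (w * of_real (\<nu> - \<mu>)))" \<nu>\<^sub>0 \<nu>]
  by (simp add: interval_lebesgue_integrable_def continuous_intros)

section \<open>Interchange of the order of integration\<close>

lemma fractional_Fubini:
  fixes K :: "real \<Rightarrow> real \<Rightarrow> real" and \<nu>\<^sub>0 \<nu> :: real and c d :: ereal
  assumes "Re a > 0" "\<nu>\<^sub>0 \<le> \<nu>" "c \<le> d"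
    and K[measurable]: "(\<lambda>(\<mu>, x). K \<mu> x) \<in> borel_measurable (borel \<Otimes>\<^sub>M borel)"
    and q: "interval_lebesgue_integrable lborel c d q"
    and bound: "\<And>\<mu> x. \<nu>\<^sub>0 < \<mu> \<Longrightarrow> \<mu> < \<nu> \<Longrightarrow> x \<in> einterval c d \<Longrightarrow> \<bar>K \<mu> x\<bar> \<le> q x"
  defines "wt \<equiv> \<lambda>\<mu>. complex_of_real (\<nu> - \<mu>) powr (a - 1)"
  shows "interval_lebesgue_integrable lborel (ereal \<nu>\<^sub>0) (ereal \<nu>) (\<lambda>\<mu>. wt \<mu> * of_real (LBINT x=c..d. K \<mu> x))"
    and "interval_lebesgue_integrable lborel c d (\<lambda>x. LBINT \<mu>=ereal \<nu>\<^sub>0..ereal \<nu>. wt \<mu> * of_real (K \<mu> x))"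
    and "(LBINT \<mu>=ereal \<nu>\<^sub>0..ereal \<nu>. wt \<mu> * of_real (LBINT x=c..d. K \<mu> x)) =
      (LBINT x=c..d. (LBINT \<mu>=ereal \<nu>\<^sub>0..ereal \<nu>. wt \<mu> * of_real (K \<mu> x)))"
proof -
  define A where "A = {\<nu>\<^sub>0<..<\<nu>}"
  define X where "X = einterval c d"
  have [measurable]: "A \<in> sets borel" "X \<in> sets borel" by (simp_all add: A_def X_def)
  define u where "u \<mu> = indicator A \<mu> *\<^sub>R wt \<mu>" for \<mu>
  define v where "v \<mu> x = indicator X x *\<^sub>R complex_of_real (K \<mu> x)" for \<mu> x
  have u: "integrable lborel u"
    using set_integrable_complex_power[OF assms(1), of \<nu>\<^sub>0 \<nu>]
    by (simp add: set_integrable_def u_def[abs_def] A_def wt_def)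
  have q': "integrable lborel (\<lambda>x. indicator X x * q x)"
    using q assms(3) by (simp add: interval_lebesgue_integrable_def set_integrable_def X_def)
  have [measurable]: "u \<in> borel_measurable borel" using u by auto
  have [measurable]: "(\<lambda>x. indicator X x * q x) \<in> borel_measurable borel" using q' by auto
  have [measurable]: "(\<lambda>(\<mu>, x). v \<mu> x) \<in> borel_measurable (borel \<Otimes>\<^sub>M borel)"
    unfolding v_def by measurable
  \<comment> \<open>Since \<open>q\<close> does not depend on \<mu>, the double integrand is
    dominated by a product of an integrable weight in \<mu> and an integrable function of
    \<open>x\<close>.\<close>
  have uq: "integrable (lborel \<Otimes>\<^sub>M lborel) (\<lambda>(\<mu>, x). u \<mu> * of_real (indicator X x * q x))"
  proof (rule lborel_pair.Fubini_integrable)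
    have "integrable lborel (\<lambda>\<mu>. norm (u \<mu>) * (\<integral>x. norm (indicator X x * q x) \<partial>lborel))"
      using u by simp
    thus "integrable lborel (\<lambda>\<mu>. \<integral>x. norm (case (\<mu>, x) of (\<mu>, x) \<Rightarrow> u \<mu> * of_real (indicator X x * q x)) \<partial>lborel)"
      by (simp add: norm_mult del: of_real_mult)
    show "AE \<mu> in lborel. integrable lborel (\<lambda>x. case (\<mu>, x) of (\<mu>, x) \<Rightarrow> u \<mu> * of_real (indicator X x * q x))"
      using q' by (simp del: of_real_mult)
  qed measurable
  have int: "integrable (lborel \<Otimes>\<^sub>M lborel) (\<lambda>(\<mu>, x). u \<mu> * v \<mu> x)"
  proof (rule Bochner_Integration.integrable_bound[OF uq])
    have "norm (u \<mu> * v \<mu> x) \<le> norm (u \<mu> * of_real (indicator X x * q x))" for \<mu> x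
    proof (cases "\<mu> \<in> A \<and> x \<in> X")
      case True
      hence "\<bar>K \<mu> x\<bar> \<le> \<bar>q x\<bar>" using bound[of \<mu> x] by (auto simp: A_def X_def)
      thus ?thesis using True by (simp add: norm_mult v_def mult_left_mono)
    qed (auto simp: u_def v_def)
    thus "AE z in lborel \<Otimes>\<^sub>M lborel. norm (case z of (\<mu>, x) \<Rightarrow> u \<mu> * v \<mu> x) \<le>
        norm (case z of (\<mu>, x) \<Rightarrow> u \<mu> * of_real (indicator X x * q x))"
      by auto
  qed measurable
  have v: "(\<integral>x. u \<mu> * v \<mu> x \<partial>lborel) = indicator A \<mu> *\<^sub>R (wt \<mu> * of_real (LBINT x=c..d. K \<mu> x))" for \<mu>
  proof -
    have "(\<integral>x. v \<mu> x \<partial>lborel) = of_real (LBINT x=c..d. K \<mu> x)"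
      using assms(3) by (simp add: v_def interval_lebesgue_integral_def set_lebesgue_integral_def X_def
          scaleR_conv_of_real flip: integral_complex_of_real)
    thus ?thesis by (simp add: u_def)
  qed
  have w: "(\<integral>\<mu>. u \<mu> * v \<mu> x \<partial>lborel) = indicator X x *\<^sub>R (LBINT \<mu>=ereal \<nu>\<^sub>0..ereal \<nu>. wt \<mu> * of_real (K \<mu> x))" for x
    using assms(2) by (simp add: u_def v_def interval_lebesgue_integral_def set_lebesgue_integral_def A_def
          scaleR_conv_of_real mult_ac flip: integral_mult_right_zero)
  show "interval_lebesgue_integrable lborel (ereal \<nu>\<^sub>0) (ereal \<nu>) (\<lambda>\<mu>. wt \<mu> * of_real (LBINT x=c..d. K \<mu> x))"
    using lborel_pair.integrable_fst[OF int] assms(2) unfolding v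
    by (simp add: interval_lebesgue_integrable_def set_integrable_def A_def)
  show "interval_lebesgue_integrable lborel c d (\<lambda>x. LBINT \<mu>=ereal \<nu>\<^sub>0..ereal \<nu>. wt \<mu> * of_real (K \<mu> x))"
    using lborel_pair.integrable_snd[OF int] assms(3) unfolding w
    by (simp add: interval_lebesgue_integrable_def set_integrable_def X_def)
  have "(LBINT \<mu>=ereal \<nu>\<^sub>0..ereal \<nu>. wt \<mu> * of_real (LBINT x=c..d. K \<mu> x)) =
      (\<integral>\<mu>. indicator A \<mu> *\<^sub>R (wt \<mu> * of_real (LBINT x=c..d. K \<mu> x)) \<partial>lborel)"
    using assms(2) unfolding interval_lebesgue_integral_def[of _ "ereal \<nu>\<^sub>0"]
    by (simp add: set_lebesgue_integral_def A_def)
  also have "\<dots> = (\<integral>x. indicator X x *\<^sub>R (LBINT \<mu>=ereal \<nu>\<^sub>0..ereal \<nu>. wt \<mu> * of_real (K \<mu> x)) \<partial>lborel)"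
    using lborel_pair.Fubini_integral[OF int] unfolding v w by (rule sym)
  also have "\<dots> = (LBINT x=c..d. (LBINT \<mu>=ereal \<nu>\<^sub>0..ereal \<nu>. wt \<mu> * of_real (K \<mu> x)))"
    using assms(3) unfolding interval_lebesgue_integral_def[of _ c]
    by (simp add: set_lebesgue_integral_def X_def)
  finally show "(LBINT \<mu>=ereal \<nu>\<^sub>0..ereal \<nu>. wt \<mu> * of_real (LBINT x=c..d. K \<mu> x)) =
      (LBINT x=c..d. (LBINT \<mu>=ereal \<nu>\<^sub>0..ereal \<nu>. wt \<mu> * of_real (K \<mu> x)))" .
qed

section \<open>The two kernels as combinations of conjugate exponentials\<close>

lemma frac_exp_kernel:
  fixes b :: complex
  assumes "Re a > 0" "\<nu>\<^sub>0 \<le> \<nu>"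
  shows "(p * frac_exp \<nu>\<^sub>0 \<nu> a w + p' * frac_exp \<nu>\<^sub>0 \<nu> a w') / b =
    (LBINT \<mu>=ereal \<nu>\<^sub>0..ereal \<nu>. of_real (\<nu> - \<mu>) powr (a - 1) *
      ((p * exp (- (w * of_real (\<nu> - \<mu>))) + p' * exp (- (w' * of_real (\<nu> - \<mu>)))) / b))"
proof -
  note i = frac_exp_integrable[OF assms]
  have "(LBINT \<mu>=ereal \<nu>\<^sub>0..ereal \<nu>.
      p * (of_real (\<nu> - \<mu>) powr (a - 1) * exp (- (w * of_real (\<nu> - \<mu>)))) +
      p' * (of_real (\<nu> - \<mu>) powr (a - 1) * exp (- (w' * of_real (\<nu> - \<mu>))))) =
    p * frac_exp \<nu>\<^sub>0 \<nu> a w + p' * frac_exp \<nu>\<^sub>0 \<nu> a w'"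
    unfolding frac_exp_def
    using i by (subst interval_lebesgue_integral_add(2)) (auto simp del: of_real_diff)
  hence "(p * frac_exp \<nu>\<^sub>0 \<nu> a w + p' * frac_exp \<nu>\<^sub>0 \<nu> a w') / b =
    (LBINT \<mu>=ereal \<nu>\<^sub>0..ereal \<nu>.
      (p * (of_real (\<nu> - \<mu>) powr (a - 1) * exp (- (w * of_real (\<nu> - \<mu>)))) +
      p' * (of_real (\<nu> - \<mu>) powr (a - 1) * exp (- (w' * of_real (\<nu> - \<mu>))))) / b)"
    by (simp only: interval_lebesgue_integral_divide)
  also have "\<dots> = (LBINT \<mu>=ereal \<nu>\<^sub>0..ereal \<nu>. of_real (\<nu> - \<mu>) powr (a - 1) *
      ((p * exp (- (w * of_real (\<nu> - \<mu>))) + p' * exp (- (w' * of_real (\<nu> - \<mu>)))) / b))"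
    by (simp only: distrib_left mult_ac times_divide_eq_right)
  finally show ?thesis .
qed

text \<open>For \<open>w = - \<i> * x\<close> the power \<open>w powr a\<close> is
  \<open>x powr a\<close> times \<open>exp (- \<i> * pi * a / 2)\<close>. The second factor cancels
  the shift by \<open>pi * a / 2\<close> in the exponent, and the first cancels the prefactor.
  Conjugation adds the term for \<open>w = \<i> * x\<close>, and the two exponentials combine to a
  cosine.\<close>

lemma arc_Re_param:
  fixes \<nu>\<^sub>0 \<nu> t x :: real
  assumes "Re \<alpha> > 0" "\<nu>\<^sub>0 \<le> \<nu>" "x > 0"
  shows "of_real x powr (- \<alpha>) * Re_param (\<lambda>a.
      exp (\<i> * (of_real (t * sin x - \<nu> * x) + of_real pi * a / 2))
        * reg_lower_gamma a (- \<i> * of_real x * of_real (\<nu> - \<nu>\<^sub>0))) \<alpha>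
    = 1 / Gamma \<alpha> * (LBINT \<mu>=ereal \<nu>\<^sub>0..ereal \<nu>. of_real (\<nu> - \<mu>) powr (\<alpha> - 1) * of_real (cos (t * sin x - \<mu> * x)))"
    (is "_ * Re_param ?F \<alpha> = _")
proof -
  define \<theta> where "\<theta> = t * sin x - \<nu> * x"
  have F: "?F a = of_real x powr a * (cis \<theta> / Gamma a * frac_exp \<nu>\<^sub>0 \<nu> a (- \<i> * of_real x))" if "Re a > 0" for a
  proof -
    \<comment> \<open>A positive factor only adds its real logarithm, so no multiple of 2 \<pi>
      enters.\<close>
    have "Ln (of_real x * - \<i>) = of_real (ln x) + Ln (- \<i>)"
      using assms(3) by (simp only: Ln_times_of_real Ln_of_real neg_equal_0_iff_equal complex_i_not_zero not_False_eq_True)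
    hence "Ln (- \<i> * of_real x) = of_real (ln x) - \<i> * pi / 2"
      by (simp add: mult.commute)
    hence p: "(- \<i> * of_real x) powr a = exp (a * (of_real (ln x) - \<i> * pi / 2))"
      using assms(3) by (simp add: powr_def)
    have "of_real x powr a = exp (a * of_real (ln x))"
      using assms(3) by (simp add: powr_def Ln_of_real)
    hence e1: "exp (\<i> * of_real pi * a / 2) * (- \<i> * of_real x) powr a = of_real x powr a"
      unfolding p exp_add[symmetric] by (simp add: algebra_simps)
    have e2: "exp (\<i> * (of_real \<theta> + of_real pi * a / 2)) = cis \<theta> * exp (\<i> * of_real pi * a / 2)"
      by (simp add: cis_conv_exp distrib_left mult.assoc flip: exp_add)
    have e3: "reg_lower_gamma a (- \<i> * of_real x * of_real (\<nu> - \<nu>\<^sub>0)) =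
        (- \<i> * of_real x) powr a / Gamma a * frac_exp \<nu>\<^sub>0 \<nu> a (- \<i> * of_real x)"
      using assms that by (intro reg_lower_gamma_conv_frac_exp) auto
    show ?thesis
      unfolding \<theta>_def[symmetric] e2 e3 e1[symmetric] by (simp only: mult_ac times_divide_eq_right times_divide_eq_left)
  qed
  have cx: "cnj (of_real x powr cnj \<alpha>) = of_real x powr \<alpha>"
    using assms(3) by (subst cnj_powr) auto
  have k: "(cis \<theta> * exp (- (- \<i> * of_real x * of_real (\<nu> - \<mu>))) +
        cis (- \<theta>) * exp (- (\<i> * of_real x * of_real (\<nu> - \<mu>)))) / 2 = of_real (cos (t * sin x - \<mu> * x))" for \<mu>
  proof -
    have e: "cis \<theta> * exp (- (- \<i> * of_real x * of_real (\<nu> - \<mu>))) = cis (t * sin x - \<mu> * x)"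
      "cis (- \<theta>) * exp (- (\<i> * of_real x * of_real (\<nu> - \<mu>))) = cis (- (t * sin x - \<mu> * x))"
      unfolding cis_conv_exp exp_add[symmetric] by (simp_all add: \<theta>_def algebra_simps)
    show ?thesis unfolding e by (simp add: complex_eq_iff del: minus_diff_eq)
  qed
  have cF: "cnj (?F (cnj \<alpha>)) = of_real x powr \<alpha> * (cis (- \<theta>) / Gamma \<alpha> * frac_exp \<nu>\<^sub>0 \<nu> \<alpha> (\<i> * of_real x))"
    using assms(1) by (subst F) (simp_all add: cx cnj_frac_exp[OF assms(2)] cis_cnj cnj_Gamma)
  have "Re_param ?F \<alpha> = of_real x powr \<alpha> * (1 / Gamma \<alpha> * ((cis \<theta> * frac_exp \<nu>\<^sub>0 \<nu> \<alpha> (- \<i> * of_real x)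
      + cis (- \<theta>) * frac_exp \<nu>\<^sub>0 \<nu> \<alpha> (\<i> * of_real x)) / 2))"
    unfolding Re_param_def cF F[OF assms(1)]
    by (simp add: distrib_left add_divide_distrib mult_ac)
  hence "of_real x powr (- \<alpha>) * Re_param ?F \<alpha> = 1 / Gamma \<alpha> * ((cis \<theta> * frac_exp \<nu>\<^sub>0 \<nu> \<alpha> (- \<i> * of_real x)
      + cis (- \<theta>) * frac_exp \<nu>\<^sub>0 \<nu> \<alpha> (\<i> * of_real x)) / 2)"
    using assms(3) by (simp add: powr_minus)
  also have "\<dots> = 1 / Gamma \<alpha> * (LBINT \<mu>=ereal \<nu>\<^sub>0..ereal \<nu>. of_real (\<nu> - \<mu>) powr (\<alpha> - 1) *
      ((cis \<theta> * exp (- (- \<i> * of_real x * of_real (\<nu> - \<mu>))) +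
        cis (- \<theta>) * exp (- (\<i> * of_real x * of_real (\<nu> - \<mu>)))) / 2))"
    by (simp only: frac_exp_kernel[OF assms(1,2)])
  finally show ?thesis unfolding k .
qed

text \<open>With \<open>w = \<i> * pi - x\<close> the division by \<open>w powr a\<close> cancels
  the power coming from the incomplete gamma function, so no power of \<open>w\<close> has to be
  conjugated. What remains is \<open>exp (w * \<mu>)\<close> minus its conjugate, divided by
  \<open>2 * \<i>\<close>.\<close>

lemma ray_Im_param:
  fixes \<nu>\<^sub>0 \<nu> x :: real
  assumes "Re \<alpha> > 0" "\<nu>\<^sub>0 \<le> \<nu>"
  shows "Im_param (\<lambda>a. exp ((\<i> * of_real pi - of_real x) * of_real \<nu>)
        * (reg_lower_gamma a ((\<i> * of_real pi - of_real x) * of_real (\<nu> - \<nu>\<^sub>0))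
          / (\<i> * of_real pi - of_real x) powr a)) \<alpha>
    = 1 / Gamma \<alpha> * (LBINT \<mu>=ereal \<nu>\<^sub>0..ereal \<nu>. of_real (\<nu> - \<mu>) powr (\<alpha> - 1) *
        of_real (sin (pi * \<mu>) * exp (- \<mu> * x)))"
    (is "Im_param ?G \<alpha> = _")
proof -
  define w where "w = \<i> * of_real pi - of_real x"
  have "Im w = pi" by (simp add: w_def)
  hence w0: "w \<noteq> 0" by auto
  have G: "?G a = exp (w * of_real \<nu>) / Gamma a * frac_exp \<nu>\<^sub>0 \<nu> a w" if "Re a > 0" for a
    using reg_lower_gamma_conv_frac_exp[OF that w0 assms(2)] w0 by (simp add: w_def[symmetric])
  have k: "(exp (w * of_real \<nu>) * exp (- (w * of_real (\<nu> - \<mu>))) +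
        (- exp (cnj w * of_real \<nu>)) * exp (- (cnj w * of_real (\<nu> - \<mu>)))) / (2 * \<i>) =
      of_real (sin (pi * \<mu>) * exp (- \<mu> * x))" for \<mu>
  proof -
    have e: "exp (w * of_real \<nu>) * exp (- (w * of_real (\<nu> - \<mu>))) = exp (w * of_real \<mu>)"
      "(- exp (cnj w * of_real \<nu>)) * exp (- (cnj w * of_real (\<nu> - \<mu>))) = - cnj (exp (w * of_real \<mu>))"
      by (simp_all add: exp_cnj algebra_simps flip: exp_add)
    have e': "exp (w * of_real \<mu>) = of_real (exp (- \<mu> * x)) * cis (pi * \<mu>)"
      by (simp add: exp_eq_polar w_def mult.commute)
    show ?thesis unfolding e e' add_uminus_conv_diff complex_diff_cnj by (simp add: mult_ac)
  qed
  have cG: "cnj (?G (cnj \<alpha>)) = exp (cnj w * of_real \<nu>) / Gamma \<alpha> * frac_exp \<nu>\<^sub>0 \<nu> \<alpha> (cnj w)"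
    using assms(1) by (subst G) (simp_all add: cnj_frac_exp[OF assms(2)] exp_cnj cnj_Gamma)
  have "Im_param ?G \<alpha> = 1 / Gamma \<alpha> * ((exp (w * of_real \<nu>) * frac_exp \<nu>\<^sub>0 \<nu> \<alpha> w
      + (- exp (cnj w * of_real \<nu>)) * frac_exp \<nu>\<^sub>0 \<nu> \<alpha> (cnj w)) / (2 * \<i>))"
    unfolding Im_param_def cG G[OF assms(1)]
    by (simp add: right_diff_distrib diff_divide_distrib mult_ac)
  also have "\<dots> = 1 / Gamma \<alpha> * (LBINT \<mu>=ereal \<nu>\<^sub>0..ereal \<nu>. of_real (\<nu> - \<mu>) powr (\<alpha> - 1) *
      ((exp (w * of_real \<nu>) * exp (- (w * of_real (\<nu> - \<mu>))) +
        (- exp (cnj w * of_real \<nu>)) * exp (- (cnj w * of_real (\<nu> - \<mu>)))) / (2 * \<i>)))"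
    by (simp only: frac_exp_kernel[OF assms])
  finally show ?thesis unfolding k .
qed

section \<open>Assembly of the formula for the Bessel function\<close>

theorem mainTheorem8:
  fixes \<alpha> :: complex and t \<nu>\<^sub>0 \<nu> :: real
  assumes "Re \<alpha> > 0" and "t > 0" and "\<nu>\<^sub>0 \<le> \<nu>"
  shows
    "let J = (\<lambda>\<mu>::real. bessel_J (of_real \<mu>) (of_real t));
         F = (\<lambda>(x::real) (a::complex).
                exp (\<i> * (of_real (t * sin x - \<nu> * x) + of_real pi * a / 2))
                * reg_lower_gamma a (- \<i> * of_real x * of_real (\<nu> - \<nu>\<^sub>0)));
         G = (\<lambda>(x::real) (a::complex).
                exp ((\<i> * of_real pi - of_real x) * of_real \<nu>)
                * (reg_lower_gamma a ((\<i> * of_real pi - of_real x) * of_real (\<nu> - \<nu>\<^sub>0))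
                   / (\<i> * of_real pi - of_real x) powr a))
     in interval_lebesgue_integrable lborel (ereal \<nu>\<^sub>0) (ereal \<nu>) (frac_integrand \<alpha> J \<nu>)
      \<and> interval_lebesgue_integrable lborel 0 (ereal pi)
          (\<lambda>x. of_real x powr (- \<alpha>) * Re_param (F x) \<alpha>)
      \<and> interval_lebesgue_integrable lborel 0 \<infinity>
          (\<lambda>x. of_real (exp (- t * sinh x)) * Im_param (G x) \<alpha>)
      \<and> frac_integral \<alpha> \<nu>\<^sub>0 J \<nu> =
          1 / of_real pi *
            ((LBINT x=0..ereal pi. of_real x powr (- \<alpha>) * Re_param (F x) \<alpha>)
             - (LBINT x=0..\<infinity>. of_real (exp (- t * sinh x)) * Im_param (G x) \<alpha>))
      \<and> (\<alpha> \<in> \<real> \<longrightarrow>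
          frac_integral \<alpha> \<nu>\<^sub>0 J \<nu> =
            1 / of_real pi *
              ((LBINT x=0..ereal pi. of_real x powr (- \<alpha>) * of_real (Re (F x \<alpha>)))
               - (LBINT x=0..\<infinity>. of_real (exp (- t * sinh x) * Im (G x \<alpha>)))))"
proof -
  define J where "J = (\<lambda>\<mu>::real. bessel_J (of_real \<mu>) (of_real t))"
  define F where "F = (\<lambda>(x::real) (a::complex).
                exp (\<i> * (of_real (t * sin x - \<nu> * x) + of_real pi * a / 2))
                * reg_lower_gamma a (- \<i> * of_real x * of_real (\<nu> - \<nu>\<^sub>0)))"
  define G where "G = (\<lambda>(x::real) (a::complex).
                exp ((\<i> * of_real pi - of_real x) * of_real \<nu>)
                * (reg_lower_gamma a ((\<i> * of_real pi - of_real x) * of_real (\<nu> - \<nu>\<^sub>0))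
                   / (\<i> * of_real pi - of_real x) powr a))"
  define wt where "wt \<mu> = complex_of_real (\<nu> - \<mu>) powr (\<alpha> - 1)" for \<mu>
  define KA where "KA \<mu> x = cos (t * sin x - \<mu> * x)" for \<mu> x
  define KR where "KR \<mu> x = exp (- t * sinh x) * (sin (pi * \<mu>) * exp (- \<mu> * x))" for \<mu> x
  define FA where "FA x = 1 / Gamma \<alpha> * (LBINT \<mu>=ereal \<nu>\<^sub>0..ereal \<nu>. wt \<mu> * of_real (KA \<mu> x))" for x
  define FR where "FR x = 1 / Gamma \<alpha> * (LBINT \<mu>=ereal \<nu>\<^sub>0..ereal \<nu>. wt \<mu> * of_real (KR \<mu> x))" for x
  have einf: "einterval 0 \<infinity> = {0::real<..}" by (auto simp: einterval_def)
  have epi: "einterval 0 (ereal pi) = {0<..<pi}" by (simp add: zero_ereal_def)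

  \<comment> \<open>Positive \<open>x\<close> suffice, because the interval integrals run over the
    open interval.\<close>
  have arc: "of_real x powr (- \<alpha>) * Re_param (F x) \<alpha> = FA x" if "x > 0" for x
    using arc_Re_param[OF assms(1,3) that, of t] by (simp add: F_def FA_def wt_def KA_def)
  have ray: "of_real (exp (- t * sinh x)) * Im_param (G x) \<alpha> = FR x" for x
  proof -
    have "FR x = 1 / Gamma \<alpha> * (LBINT \<mu>=ereal \<nu>\<^sub>0..ereal \<nu>. of_real (exp (- t * sinh x)) *
        (of_real (\<nu> - \<mu>) powr (\<alpha> - 1) * of_real (sin (pi * \<mu>) * exp (- \<mu> * x))))"
      unfolding FR_def KR_def wt_def of_real_mult by (simp only: mult_ac)
    also have "\<dots> = of_real (exp (- t * sinh x)) * Im_param (G x) \<alpha>"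
      unfolding G_def ray_Im_param[OF assms(1,3)] interval_lebesgue_integral_mult_right by (simp only: mult_ac)
    finally show ?thesis ..
  qed

  have qA: "interval_lebesgue_integrable lborel 0 (ereal pi) (\<lambda>_. 1 :: real)"
    unfolding zero_ereal_def by (rule interval_integrable_continuous_on) auto
  have bA: "\<bar>KA \<mu> x\<bar> \<le> 1" for \<mu> x by (simp add: KA_def)
  have mA: "(\<lambda>(\<mu>, x). KA \<mu> x) \<in> borel_measurable (borel \<Otimes>\<^sub>M borel)"
    unfolding KA_def by measurable
  have pi0: "0 \<le> ereal pi" by simp
  note A = fractional_Fubini[OF assms(1,3) pi0 mA qA bA, folded wt_def]

  \<comment> \<open>\<open>M\<close> bounds the absolute value of \<mu> on the interval. For
    \<open>x > 0\<close> the inequality \<open>2 * sinh x \<ge> exp x - 1\<close> bounds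
    \<open>exp (- t * sinh x)\<close> by \<open>exp (t / 2) * exp (- (t / 2) * exp x)\<close>, so
    the majorant is independent of \<mu> and \<open>integrable_exp_exp\<close> applies to
    it.\<close>
  define M where "M = \<bar>\<nu>\<^sub>0\<bar> + \<bar>\<nu>\<bar>"
  have qR: "interval_lebesgue_integrable lborel 0 \<infinity> (\<lambda>x. exp (t / 2) * exp (M * x - t / 2 * exp x))"
    using integrable_exp_exp[of "t / 2" 0 M] assms(2) by (simp add: interval_lebesgue_integrable_def einf)
  have bR: "\<bar>KR \<mu> x\<bar> \<le> exp (t / 2) * exp (M * x - t / 2 * exp x)"
    if "\<nu>\<^sub>0 < \<mu>" "\<mu> < \<nu>" "x \<in> einterval 0 \<infinity>" for \<mu> x
  proof -
    have x: "x > 0" using that(3) by (simp add: einf)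
    have "- t * sinh x - \<mu> * x \<le> t / 2 + (M * x - t / 2 * exp x)"
    proof -
      have "- \<mu> * x \<le> M * x" using that x by (intro mult_right_mono) (auto simp: M_def)
      moreover have "t * (exp x - 1) \<le> t * (2 * sinh x)"
        using assms(2) x by (intro mult_left_mono) (auto simp: sinh_field_def)
      ultimately show ?thesis by (simp add: algebra_simps)
    qed
    hence "exp (- t * sinh x) * exp (- \<mu> * x) \<le> exp (t / 2) * exp (M * x - t / 2 * exp x)"
      by (simp flip: exp_add)
    moreover have "\<bar>KR \<mu> x\<bar> \<le> exp (- t * sinh x) * (1 * exp (- \<mu> * x))"
      unfolding KR_def abs_mult by (intro mult_mono) auto
    ultimately show ?thesis by simp
  qed
  have [measurable]: "(sinh :: real \<Rightarrow> real) \<in> borel_measurable borel"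
    by (intro borel_measurable_continuous_onI continuous_intros)
  have mR: "(\<lambda>(\<mu>, x). KR \<mu> x) \<in> borel_measurable (borel \<Otimes>\<^sub>M borel)"
    unfolding KR_def by measurable
  have inf0: "0 \<le> (\<infinity>::ereal)" by simp
  note R = fractional_Fubini[OF assms(1,3) inf0 mR qR bR, folded wt_def]

  have fi: "frac_integrand \<alpha> J \<nu> = (\<lambda>\<mu>. 1 / of_real pi *
      (wt \<mu> * of_real (LBINT x=0..ereal pi. KA \<mu> x) - wt \<mu> * of_real (LBINT x=0..\<infinity>. KR \<mu> x)))"
    unfolding frac_integrand_def J_def bessel_J_Schlaefli[OF assms(2)] wt_def KA_def KR_def
    by (intro ext) (simp add: algebra_simps)
  have 1: "interval_lebesgue_integrable lborel (ereal \<nu>\<^sub>0) (ereal \<nu>) (frac_integrand \<alpha> J \<nu>)"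
    unfolding fi
    by (intro interval_lebesgue_integrable_mult_right interval_lebesgue_integral_diff(1) A(1) R(1))
  have iA: "interval_lebesgue_integrable lborel 0 (ereal pi) FA"
    unfolding FA_def by (intro interval_lebesgue_integrable_mult_right A(2))
  have 2: "interval_lebesgue_integrable lborel 0 (ereal pi) (\<lambda>x. of_real x powr (- \<alpha>) * Re_param (F x) \<alpha>)"
  proof -
    have "set_integrable lborel {0<..<pi} (\<lambda>x. of_real x powr (- \<alpha>) * Re_param (F x) \<alpha>) =
        set_integrable lborel {0<..<pi} FA"
      by (rule set_integrable_cong) (auto simp: arc)
    thus ?thesis using iA by (simp add: interval_lebesgue_integrable_def epi)
  qed
  have 3: "interval_lebesgue_integrable lborel 0 \<infinity> (\<lambda>x. of_real (exp (- t * sinh x)) * Im_param (G x) \<alpha>)"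
    unfolding ray unfolding FR_def by (intro interval_lebesgue_integrable_mult_right R(2))
  have FAint: "(LBINT x=0..ereal pi. of_real x powr (- \<alpha>) * Re_param (F x) \<alpha>) = (LBINT x=0..ereal pi. FA x)"
    by (rule interval_integral_cong) (simp add: min_def max_def epi arc)
  have diff: "(LBINT \<mu>=ereal \<nu>\<^sub>0..ereal \<nu>.
        wt \<mu> * of_real (LBINT x=0..ereal pi. KA \<mu> x) - wt \<mu> * of_real (LBINT x=0..\<infinity>. KR \<mu> x)) =
      (LBINT \<mu>=ereal \<nu>\<^sub>0..ereal \<nu>. wt \<mu> * of_real (LBINT x=0..ereal pi. KA \<mu> x)) -
      (LBINT \<mu>=ereal \<nu>\<^sub>0..ereal \<nu>. wt \<mu> * of_real (LBINT x=0..\<infinity>. KR \<mu> x))"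
    by (rule interval_lebesgue_integral_diff(2)[OF A(1) R(1)])
  have "frac_integral \<alpha> \<nu>\<^sub>0 J \<nu> = 1 / Gamma \<alpha> * (1 / of_real pi *
      ((LBINT \<mu>=ereal \<nu>\<^sub>0..ereal \<nu>. wt \<mu> * of_real (LBINT x=0..ereal pi. KA \<mu> x)) -
       (LBINT \<mu>=ereal \<nu>\<^sub>0..ereal \<nu>. wt \<mu> * of_real (LBINT x=0..\<infinity>. KR \<mu> x))))"
    unfolding frac_integral_def fi interval_lebesgue_integral_mult_right diff ..
  also have "\<dots> = 1 / Gamma \<alpha> * (1 / of_real pi *
      ((LBINT x=0..ereal pi. (LBINT \<mu>=ereal \<nu>\<^sub>0..ereal \<nu>. wt \<mu> * of_real (KA \<mu> x))) -
       (LBINT x=0..\<infinity>. (LBINT \<mu>=ereal \<nu>\<^sub>0..ereal \<nu>. wt \<mu> * of_real (KR \<mu> x)))))"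
    by (intro arg_cong2[where f="(*)"] arg_cong2[where f="(-)"] refl A(3) R(3))
  also have "\<dots> = 1 / of_real pi * ((LBINT x=0..ereal pi. FA x) - (LBINT x=0..\<infinity>. FR x))"
    unfolding FA_def FR_def interval_lebesgue_integral_mult_right by (simp add: algebra_simps)
  finally have 4: "frac_integral \<alpha> \<nu>\<^sub>0 J \<nu> = 1 / of_real pi *
      ((LBINT x=0..ereal pi. of_real x powr (- \<alpha>) * Re_param (F x) \<alpha>) -
       (LBINT x=0..\<infinity>. of_real (exp (- t * sinh x)) * Im_param (G x) \<alpha>))"
    unfolding FAint ray .
  \<comment> \<open>For real \<alpha> the continued real and imaginary parts are the ordinary
    ones.\<close>
  have 5: "frac_integral \<alpha> \<nu>\<^sub>0 J \<nu> = 1 / of_real pi *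
      ((LBINT x=0..ereal pi. of_real x powr (- \<alpha>) * of_real (Re (F x \<alpha>)))
       - (LBINT x=0..\<infinity>. of_real (exp (- t * sinh x) * Im (G x \<alpha>))))" if "\<alpha> \<in> \<real>"
    using 4 unfolding Re_param_real[OF that] Im_param_real[OF that] by (simp only: of_real_mult)
  show ?thesis
    unfolding Let_def F_def[symmetric] G_def[symmetric] J_def[symmetric]
    using 1 2 3 4 5 by blast
qed

end
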